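(* Let $a,b\ge 3$, $l\ge 0$ and $n=a+b+l-1$. Let $P^l(C_a,C_b)$ be the kayak paddle graph obtained from disjoint cycles $C_a$ and $C_b$ by joining a vertex of $C_a$ and a vertex of $C_b$ with a path of length $l$ (identifying the two vertices if $l=0$). For a composition $K\vDash n$ put $g(K)=\Theta_K(a+l)w_Ke_K$, and let \[ \mathcal H=\{(I,J): I,J\text{ nonempty compositions},\ I\!J\in\mathcal W_n,\ a+l-j_1+1\le |I|\le a-1\}. \] Then \begin{align*} X_{P^l(C_a,C_b)}&=\sum_{K\vDash n,\ k_1=1}\Theta_K^-(a)g(K)+\sum_{\substack{K\vDash n,\ \Theta_K(a)\le l\\ 2\le k_1\le l+1}}\Theta_K^-(k_1+a-1)g(K)\\ &\quad+\sum_{\substack{K\vDash n,\ \Theta_K(a)\le l\\ l+2\le k_1\le l+a-1}}\bigl(\Theta_K^-(a+l)+k_1-l-1\bigr)g(K)+\sum_{K\vDash n,\ k_1\ge a+l}(a-1)g(K)\\ &\quad+\sum_{\substack{(I,J)\in\mathcal H\\ \text{if }i_1\ge l+2\text{ then }(i_1=j_1\text{ or }|I|\ge a+i_1-j_1)}}\Bigl(a-1-|I|+\frac{j_1-i_1}{j_1-1}\Bigr)g(I\!J)\\ &\quad+\sum_{(I,J)\in\mathcal H,\ i_1>j_1}\Bigl((i_1-j_1)+(a-1-|I|)\Bigl(1+\frac{j_1}{i_1}\cdot\frac{i_1-1}{j_1-1}\Bigr)\Bigr)g(I\!J). \end{align*}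
   Context: $X_G=\sum_\kappa\prod_{v\in V(G)}x_{\kappa(v)}$ summed over proper colorings $\kappa:V(G)\to\{1,2,\dots\}$. A composition $K=k_1\cdots k_m\vDash n$ is a sequence of positive integers with sum $n$; $|K|$ is its sum; $I\!J$ denotes concatenation; $i_1,j_1$ are the first parts of $I,J$. $e_K=e_{k_1}\cdots e_{k_m}$ with $e_k$ elementary symmetric functions. $w_K=k_1(k_2-1)\cdots(k_m-1)$. $\mathcal W_n$ is the set of compositions of $n$ all of whose parts are at least $2$. For $0\le c\le n$: $\sigma_K(c)=\min\{k_1+\dots+k_j:0\le j\le m,\ k_1+\dots+k_j\ge c\}$, $\Theta_K(c)=\sigma_K(c)-c$; $\sigma^-_K(c)=\max\{k_1+\dots+k_j:0\le j\le m,\ k_1+\dots+k_j\le c\}$, $\Theta^-_K(c)=c-\sigma^-_K(c)$. *)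

theory Defs
  imports Complex_Main "HOL-Library.Multiset" "HOL-Library.FuncSet"
begin

section \<open>Formal power series in the variables x_1, x_2, ...\<close>

text \<open>
  A monomial is encoded as the finite multiset of the indices of its variables. The variable with
  index 0 exists in the type, but neither chromatic nor elementary symmetric functions involve it.
\<close>

typedef 'a mfps = "UNIV :: (nat multiset \<Rightarrow> 'a) set"
  morphisms mfps_coeff Abs_mfps ..

lemma mfps_coeff_Abs [simp]: "mfps_coeff (Abs_mfps f) = f"
  by (simp add: Abs_mfps_inverse)

lemma mfps_eq_iff: "f = g \<longleftrightarrow> (\<forall>M. mfps_coeff f M = mfps_coeff g M)"
  by (metis ext mfps_coeff_inject)

lemma mfps_ext: "(\<And>M. mfps_coeff f M = mfps_coeff g M) \<Longrightarrow> f = g"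
  by (simp add: mfps_eq_iff)

instantiation mfps :: (ab_group_add) ab_group_add
begin

definition "0 = Abs_mfps (\<lambda>_. 0)"
definition "f + g = Abs_mfps (\<lambda>M. mfps_coeff f M + mfps_coeff g M)"
definition "f - g = Abs_mfps (\<lambda>M. mfps_coeff f M - mfps_coeff g M)"
definition "- f = Abs_mfps (\<lambda>M. - mfps_coeff f M)"

instance
  by standard
    (simp_all add: mfps_eq_iff zero_mfps_def plus_mfps_def minus_mfps_def uminus_mfps_def
      algebra_simps)

end

lemma mfps_coeff_0 [simp]: "mfps_coeff 0 M = 0"
  and mfps_coeff_add [simp]: "mfps_coeff (f + g) M = mfps_coeff f M + mfps_coeff g M"
  and mfps_coeff_diff [simp]: "mfps_coeff (f - g) M = mfps_coeff f M - mfps_coeff g M"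
  and mfps_coeff_uminus [simp]: "mfps_coeff (- f) M = - mfps_coeff f M"
  by (simp_all add: zero_mfps_def plus_mfps_def minus_mfps_def uminus_mfps_def)

lemma mfps_coeff_sum: "mfps_coeff (sum f A) M = (\<Sum>i\<in>A. mfps_coeff (f i) M)"
  by (induction A rule: infinite_finite_induct) auto

lemma finite_submultisets: "finite {A. A \<subseteq># M}"
proof (rule finite_subset)
  show "{A. A \<subseteq># M} \<subseteq> mset ` {xs. set xs \<subseteq> set_mset M \<and> length xs \<le> size M}"
  proof
    fix A assume "A \<in> {A. A \<subseteq># M}"
    moreover obtain xs where "A = mset xs" using ex_mset by metis
    ultimately show "A \<in> mset ` {xs. set xs \<subseteq> set_mset M \<and> length xs \<le> size M}"
      using set_mset_mono [of A M] size_mset_mono [of A M] by auto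
  qed
qed (simp add: finite_lists_length_le)

lemma finite_msplits: "finite {(A, B). A + B = (M :: 'b multiset)}"
proof (rule finite_subset)
  show "{(A, B). A + B = M} \<subseteq> {A. A \<subseteq># M} \<times> {A. A \<subseteq># M}" by auto
qed (simp add: finite_submultisets)

instantiation mfps :: (comm_ring_1) comm_ring_1
begin

definition "1 = Abs_mfps (\<lambda>M. if M = {#} then 1 else 0)"
definition "f * g = Abs_mfps (\<lambda>M. \<Sum>(A, B) | A + B = M. mfps_coeff f A * mfps_coeff g B)"

instance
proof
  fix f g h :: "'a mfps"
  show "f * g * h = f * (g * h)"
  proof (rule mfps_ext)
    fix M
    let ?c = mfps_coeff
    have "?c (f * g * h) M =
        (\<Sum>(P, C) | P + C = M. \<Sum>(A, B) | A + B = P. ?c f A * ?c g B * ?c h C)"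
      by (simp add: times_mfps_def sum_distrib_right case_prod_unfold)
    also have "\<dots> = (\<Sum>(u, v)\<in>(SIGMA u:{(P, C). P + C = M}. {(A, B). A + B = fst u}).
        ?c f (fst v) * ?c g (snd v) * ?c h (snd u))"
      by (subst sum.Sigma [symmetric]) (use finite_msplits in \<open>auto simp: case_prod_unfold\<close>)
    also have "\<dots> = (\<Sum>(u, v)\<in>(SIGMA u:{(A, Q). A + Q = M}. {(B, C). B + C = snd u}).
        ?c f (fst u) * (?c g (fst v) * ?c h (snd v)))"
      by (rule sum.reindex_bij_witness
            [where i = "\<lambda>((A, Q), (B, C)). ((A + B, C), (A, B))"
               and j = "\<lambda>((P, C), (A, B)). ((A, B + C), (B, C))"])
         (auto simp: algebra_simps)
    also have "\<dots> = (\<Sum>(A, Q) | A + Q = M. \<Sum>(B, C) | B + C = Q. ?c f A * (?c g B * ?c h C))"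
      by (subst sum.Sigma [symmetric]) (use finite_msplits in \<open>auto simp: case_prod_unfold\<close>)
    also have "\<dots> = ?c (f * (g * h)) M"
      by (simp add: times_mfps_def sum_distrib_left case_prod_unfold)
    finally show "?c (f * g * h) M = ?c (f * (g * h)) M" .
  qed
  show "f * g = g * f"
  proof (rule mfps_ext)
    fix M
    show "mfps_coeff (f * g) M = mfps_coeff (g * f) M"
      unfolding times_mfps_def mfps_coeff_Abs
      by (rule sum.reindex_bij_witness [where i = prod.swap and j = prod.swap])
         (auto simp: algebra_simps)
  qed
  show "1 * f = f"
  proof (rule mfps_ext)
    fix M
    have "mfps_coeff (1 * f) M =
        (\<Sum>(A, B) | A + B = M. if (A, B) = ({#}, M) then mfps_coeff f M else 0)"
      unfolding times_mfps_def one_mfps_def mfps_coeff_Abs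
      by (rule sum.cong) auto
    also have "\<dots> = mfps_coeff f M"
      using finite_msplits [of M]
      by (subst sum.mono_neutral_right [where S = "{({#}, M)}"]) (auto split: if_splits)
    finally show "mfps_coeff (1 * f) M = mfps_coeff f M" .
  qed
  show "(f + g) * h = f * h + g * h"
    by (simp add: mfps_eq_iff times_mfps_def case_prod_unfold algebra_simps sum.distrib)
  show "(0 :: 'a mfps) \<noteq> 1"
    by (auto simp: mfps_eq_iff one_mfps_def)
qed

end

lemma mfps_coeff_1: "mfps_coeff 1 M = (if M = {#} then 1 else 0)"
  by (simp add: one_mfps_def)

lemma mfps_coeff_mult:
  "mfps_coeff (f * g) M = (\<Sum>(A, B) | A + B = M. mfps_coeff f A * mfps_coeff g B)"
  by (simp add: times_mfps_def)

definition mfps_const :: "'a \<Rightarrow> 'a::comm_ring_1 mfps" where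
  "mfps_const c = Abs_mfps (\<lambda>M. if M = {#} then c else 0)"

definition mfps_monom :: "nat multiset \<Rightarrow> 'a::comm_ring_1 mfps" where
  "mfps_monom N = Abs_mfps (\<lambda>M. if M = N then 1 else 0)"

definition mfps_var :: "nat \<Rightarrow> 'a::comm_ring_1 mfps" where
  "mfps_var i = mfps_monom {#i#}"

lemma mfps_coeff_const_mult [simp]: "mfps_coeff (mfps_const c * f) M = c * mfps_coeff f M"
proof -
  have "mfps_coeff (mfps_const c * f) M =
      (\<Sum>(A, B) | A + B = M. if (A, B) = ({#}, M) then c * mfps_coeff f M else 0)"
    unfolding mfps_coeff_mult mfps_const_def mfps_coeff_Abs
    by (rule sum.cong) auto
  also have "\<dots> = c * mfps_coeff f M"
    using finite_msplits [of M]
    by (subst sum.mono_neutral_right [where S = "{({#}, M)}"]) (auto split: if_splits)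
  finally show ?thesis .
qed

lemma mfps_monom_mult: "mfps_monom A * mfps_monom B = mfps_monom (A + B)"
proof (rule mfps_ext)
  fix M
  have "mfps_coeff (mfps_monom A * mfps_monom B) M =
      (\<Sum>(C, D) | C + D = M. if (C, D) = (A, B) then (1 :: 'a) else 0)"
    unfolding mfps_coeff_mult mfps_monom_def mfps_coeff_Abs
    by (rule sum.cong) auto
  also have "\<dots> = mfps_coeff (mfps_monom (A + B)) M"
  proof (cases "M = A + B")
    case True
    then show ?thesis
      using finite_msplits [of M]
      by (subst sum.mono_neutral_right [where S = "{(A, B)}"]) (auto simp: mfps_monom_def split: if_splits)
  next
    case False
    then show ?thesis
      by (intro trans [OF sum.neutral]) (auto simp: mfps_monom_def)
  qed
  finally show "mfps_coeff (mfps_monom A * mfps_monom B) M =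
      (mfps_coeff (mfps_monom (A + B)) M :: 'a)" .
qed

lemma prod_mfps_var:
  assumes "finite A"
  shows "(\<Prod>v\<in>A. mfps_var (\<kappa> v)) = mfps_monom (image_mset \<kappa> (mset_set A))"
  using assms
proof induction
  case empty
  then show ?case by (simp add: one_mfps_def mfps_monom_def)
next
  case (insert x A)
  then show ?case by (simp add: mfps_var_def mfps_monom_mult)
qed

text \<open>
  The formal sum of a possibly infinite family, taken coefficientwise. It is meaningful only for
  families in which every monomial occurs in finitely many members; this is the case for both
  families used below (see \<open>mfps_coeff_elem_sym\<close> and \<open>mfps_coeff_chrom_sym\<close>).
\<close>

definition mfps_formal_sum :: "('i \<Rightarrow> 'a::comm_ring_1 mfps) \<Rightarrow> 'i set \<Rightarrow> 'a mfps" where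
  "mfps_formal_sum f A =
    Abs_mfps (\<lambda>M. \<Sum>i | i \<in> A \<and> mfps_coeff (f i) M \<noteq> 0. mfps_coeff (f i) M)"

lemma mfps_coeff_formal_sum_monom:
  assumes "\<And>i. i \<in> A \<Longrightarrow> f i = mfps_monom (N i)"
  shows "mfps_coeff (mfps_formal_sum f A) M = of_nat (card {i \<in> A. N i = M})"
proof -
  have "{i \<in> A. mfps_coeff (f i) M \<noteq> 0} = {i \<in> A. N i = M}"
    using assms by (auto simp: mfps_monom_def split: if_splits)
  moreover have "mfps_coeff (f i) M = 1" if "i \<in> {i \<in> A. N i = M}" for i
    using assms that by (auto simp: mfps_monom_def)
  ultimately show ?thesis
    by (simp add: mfps_formal_sum_def)
qed

section \<open>Elementary symmetric functions\<close>

definition elem_sym :: "nat \<Rightarrow> 'a::comm_ring_1 mfps" where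
  "elem_sym k = mfps_formal_sum (\<lambda>S. \<Prod>i\<in>S. mfps_var i) {S. S \<subseteq> {1..} \<and> finite S \<and> card S = k}"

definition elem_sym_comp :: "nat list \<Rightarrow> 'a::comm_ring_1 mfps" where
  "elem_sym_comp K = prod_list (map elem_sym K)"

lemma mfps_coeff_elem_sym:
  "mfps_coeff (elem_sym k) M =
    (if 0 \<notin># M \<and> size M = k \<and> (\<forall>i. count M i \<le> 1) then 1 else 0)"
proof -
  let ?A = "{S. S \<subseteq> {1::nat..} \<and> finite S \<and> card S = k}"
  have *: "mfps_coeff (elem_sym k) M = of_nat (card {S \<in> ?A. mset_set S = M})"
    unfolding elem_sym_def
    by (rule mfps_coeff_formal_sum_monom) (simp add: prod_mfps_var [where \<kappa> = "\<lambda>i. i", simplified])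
  show ?thesis
  proof (cases "0 \<notin># M \<and> size M = k \<and> (\<forall>i. count M i \<le> 1)")
    case True
    have M: "mset_set (set_mset M) = M"
    proof (rule multiset_eqI)
      fix i
      show "count (mset_set (set_mset M)) i = count M i"
        using True [THEN conjunct2, THEN conjunct2, THEN spec, of i]
        by (cases "i \<in># M") (auto simp: count_mset_set' count_eq_zero_iff le_Suc_eq)
    qed
    have "card (set_mset M) = k"
      using True arg_cong [OF M, of size] by simp
    moreover have "set_mset M \<subseteq> {1..}"
    proof
      fix x assume "x \<in> set_mset M"
      with True show "x \<in> {1..}" by (cases x) auto
    qed
    ultimately have "{S \<in> ?A. mset_set S = M} = {set_mset M}"
    proof (intro equalityI subsetI)
      fix S assume "S \<in> {S \<in> ?A. mset_set S = M}"
      then have "finite S" "mset_set S = M" by auto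
      then show "S \<in> {set_mset M}" using finite_set_mset_mset_set by blast
    next
      fix S assume "S \<in> {set_mset M}"
      with M \<open>card (set_mset M) = k\<close> \<open>set_mset M \<subseteq> {1..}\<close>
      show "S \<in> {S \<in> ?A. mset_set S = M}" by simp
    qed
    with True * show ?thesis by simp
  next
    case False
    have "{S \<in> ?A. mset_set S = M} = {}"
    proof (rule ccontr)
      assume "{S \<in> ?A. mset_set S = M} \<noteq> {}"
      then obtain S where S: "S \<subseteq> {1..}" "finite S" "card S = k" "M = mset_set S" by auto
      then have "0 \<notin># M \<and> size M = k \<and> (\<forall>i. count M i \<le> 1)"
        by (auto simp: count_mset_set' dest: subsetD)
      with False show False by contradiction
    qed
    then show ?thesis
      unfolding * using False by (simp only: card.empty of_nat_0 if_False)
  qed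
qed

section \<open>Chromatic symmetric functions and kayak paddle graphs\<close>

text \<open>
  A simple graph is given by its vertex set \<open>V\<close> and its set \<open>E\<close> of edges, which are two-element
  subsets of \<open>V\<close>.
\<close>

definition proper_colorings :: "'v set \<Rightarrow> 'v set set \<Rightarrow> ('v \<Rightarrow> nat) set" where
  "proper_colorings V E = {\<kappa> \<in> V \<rightarrow>\<^sub>E {1..}. \<forall>u v. {u, v} \<in> E \<longrightarrow> \<kappa> u \<noteq> \<kappa> v}"

definition chrom_sym :: "'v set \<Rightarrow> 'v set set \<Rightarrow> 'a::comm_ring_1 mfps" where
  "chrom_sym V E = mfps_formal_sum (\<lambda>\<kappa>. \<Prod>v\<in>V. mfps_var (\<kappa> v)) (proper_colorings V E)"

lemma mfps_coeff_chrom_sym: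
  assumes "finite V"
  shows "mfps_coeff (chrom_sym V E) M =
      of_nat (card {\<kappa> \<in> proper_colorings V E. image_mset \<kappa> (mset_set V) = M})"
    and "finite {\<kappa> \<in> proper_colorings V E. image_mset \<kappa> (mset_set V) = M}"
proof -
  show "mfps_coeff (chrom_sym V E) M =
      of_nat (card {\<kappa> \<in> proper_colorings V E. image_mset \<kappa> (mset_set V) = M})"
    unfolding chrom_sym_def
    by (rule mfps_coeff_formal_sum_monom) (simp add: prod_mfps_var assms)
  show "finite {\<kappa> \<in> proper_colorings V E. image_mset \<kappa> (mset_set V) = M}"
  proof (rule finite_subset)
    show "{\<kappa> \<in> proper_colorings V E. image_mset \<kappa> (mset_set V) = M} \<subseteq> V \<rightarrow>\<^sub>E set_mset M"
      using assms by (auto simp: proper_colorings_def PiE_iff extensional_def)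
    show "finite (V \<rightarrow>\<^sub>E set_mset M)"
      by (rule finite_PiE) (use assms in auto)
  qed
qed

definition cycle_edges :: "'v list \<Rightarrow> 'v set set" where
  "cycle_edges vs = {{vs ! i, vs ! (Suc i mod length vs)} | i. i < length vs}"

definition path_edges :: "'v list \<Rightarrow> 'v set set" where
  "path_edges vs = {{vs ! i, vs ! Suc i} | i. Suc i < length vs}"

text \<open>
  \<open>us\<close> and \<open>vs\<close> list the vertices of the two cycles in cyclic order, and \<open>ps\<close> those of the path
  of length \<open>l\<close>, whose ends lie on the cycles. For \<open>l = 0\<close> the path is the single vertex shared by
  the two cycles.
\<close>

definition kayak_paddle :: "nat \<Rightarrow> nat \<Rightarrow> nat \<Rightarrow> 'v set \<Rightarrow> 'v set set \<Rightarrow> bool" where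
  "kayak_paddle a b l V E \<longleftrightarrow>
    (\<exists>us vs ps.
      distinct us \<and> length us = a \<and> distinct vs \<and> length vs = b \<and>
      distinct ps \<and> length ps = l + 1 \<and>
      set us \<inter> set ps = {hd ps} \<and> set vs \<inter> set ps = {last ps} \<and>
      set us \<inter> set vs = (if l = 0 then {hd ps} else {}) \<and>
      V = set us \<union> set ps \<union> set vs \<and>
      E = cycle_edges us \<union> path_edges ps \<union> cycle_edges vs)"

lemma kayak_paddle_exists:
  assumes "a \<ge> 3" "b \<ge> 3"
  shows "\<exists>E. kayak_paddle a b l {0..<a + b + l - 1} E"
proof
  let ?us = "[0..<a]" and ?ps = "[a - 1..<a + l]" and ?vs = "[a + l - 1..<a + b + l - 1]"
  show "kayak_paddle a b l {0..<a + b + l - 1}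
      (cycle_edges ?us \<union> path_edges ?ps \<union> cycle_edges ?vs)"
    unfolding kayak_paddle_def
    by (rule exI [of _ ?us], rule exI [of _ ?vs], rule exI [of _ ?ps]) (use assms in auto)
qed

section \<open>Compositions\<close>

definition compositions :: "nat \<Rightarrow> nat list set" where
  "compositions n = {K. (\<forall>k\<in>set K. k \<ge> 1) \<and> sum_list K = n}"

definition compositions_ge2 :: "nat \<Rightarrow> nat list set" where
  "compositions_ge2 n = {K \<in> compositions n. \<forall>k\<in>set K. k \<ge> 2}"

lemma finite_compositions: "finite (compositions n)"
proof (rule finite_subset)
  have "length K \<le> sum_list K" if "\<forall>k\<in>set K. k \<ge> 1" for K :: "nat list"
    using that by (induction K) auto
  moreover have "k \<le> sum_list K" if "k \<in> set K" for k :: nat and K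
    using that by (simp add: member_le_sum_list)
  ultimately show "compositions n \<subseteq> {K. set K \<subseteq> {..n} \<and> length K \<le> n}"
    by (fastforce simp: compositions_def)
  show "finite {K. set K \<subseteq> {..n} \<and> length K \<le> n}"
    by (rule finite_lists_length_le) simp
qed

definition partial_sums :: "nat list \<Rightarrow> nat set" where
  "partial_sums K = {sum_list (take j K) | j. j \<le> length K}"

text \<open>
  The next four functions are meant for \<open>0 \<le> c \<le> sum_list K\<close>; the minimum and maximum are then over
  nonempty finite sets, and the subtractions on \<open>nat\<close> do not truncate.
\<close>

definition sigma_up :: "nat list \<Rightarrow> nat \<Rightarrow> nat" where
  "sigma_up K c = Min {s \<in> partial_sums K. c \<le> s}"

definition Theta_up :: "nat list \<Rightarrow> nat \<Rightarrow> nat" where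
  "Theta_up K c = sigma_up K c - c"

definition sigma_down :: "nat list \<Rightarrow> nat \<Rightarrow> nat" where
  "sigma_down K c = Max {s \<in> partial_sums K. s \<le> c}"

definition Theta_down :: "nat list \<Rightarrow> nat \<Rightarrow> nat" where
  "Theta_down K c = c - sigma_down K c"

text \<open>Used for nonempty compositions, whose parts are positive.\<close>

definition comp_weight :: "nat list \<Rightarrow> nat" where
  "comp_weight K = hd K * prod_list (map (\<lambda>k. k - 1) (tl K))"

definition kayak_g :: "nat \<Rightarrow> nat \<Rightarrow> nat list \<Rightarrow> rat mfps" where
  "kayak_g a l K =
    mfps_const (of_nat (Theta_up K (a + l)) * of_nat (comp_weight K)) * elem_sym_comp K"

definition kayak_H :: "nat \<Rightarrow> nat \<Rightarrow> nat \<Rightarrow> (nat list \<times> nat list) set" where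
  "kayak_H n a l =
    {(I, J). I \<noteq> [] \<and> J \<noteq> [] \<and> I @ J \<in> compositions_ge2 n \<and>
      int a + int l - int (hd J) + 1 \<le> int (sum_list I) \<and> int (sum_list I) \<le> int a - 1}"

lemma finite_kayak_H: "finite (kayak_H n a l)"
proof -
  have "kayak_H n a l \<subseteq> (\<lambda>(K, i). (take i K, drop i K)) ` (compositions n \<times> {..n})"
  proof (clarsimp simp: kayak_H_def compositions_ge2_def)
    fix I J assume IJ: "I @ J \<in> compositions n"
    have "length K \<le> sum_list K" if "\<forall>k\<in>set K. k \<ge> 1" for K :: "nat list"
      using that by (induction K) auto
    then have "length (I @ J) \<le> n"
      using IJ by (metis (mono_tags, lifting) compositions_def mem_Collect_eq)
    then have "(I @ J, length I) \<in> compositions n \<times> {..n}" using IJ by simp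
    then show "(I, J) \<in> (\<lambda>(K, i). (take i K, drop i K)) ` (compositions n \<times> {..n})"
      by (rule rev_image_eqI) simp
  qed
  then show ?thesis
    by (rule finite_subset) (simp add: finite_compositions)
qed

end

theory Submission
  imports Defs "HOL-Computational_Algebra.Formal_Power_Series"
begin

text \<open>
  For finitely many colours with weights \<open>x\<close>, colourings of cycles and paths are weighted walks on a
  complete graph, and the one-step operator is self-adjoint for the form \<open>\<Sum>\<^sub>r x\<^sub>r h(r) g(r)\<close>. Closed
  walks satisfy \<open>c\<^sub>m\<^sub>+\<^sub>1(r) = q\<^sub>m(r) - x\<^sub>r c\<^sub>m(r)\<close>, where \<open>q\<^sub>m\<close> counts the walks with \<open>m\<close> steps, so a
  cycle hanging on anything can be shortened at the price of a path and of a product with a smaller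
  cycle. Applied to both cycles, this writes the chromatic symmetric function as
  \<open>(a - 1) \<Sum>\<^sub>K g(K)\<close> minus the sum of \<open>(i\<^sub>1 - 1) w\<^sub>I w\<^sub>J \<Theta>\<^sub>I\<^sub>J(a + l) e\<^sub>I\<^sub>J\<close> over all \<open>(I, J)\<close> with
  \<open>|I| \<le> a - 1\<close>.

  If \<open>|I| + j\<^sub>1 \<le> a + l\<close>, then moving \<open>j\<^sub>1\<close> to the front and reversing \<open>I\<close> does not change
  \<open>\<Theta>\<^sub>I\<^sub>J(a + l)\<close>, and the terms with a given result \<open>K\<close> add up to a partial sum of \<open>K\<close>; this gives
  the values of \<open>\<Theta>\<^sup>-\<close>. The other pairs are those of \<open>\<H>\<close>, up to zero terms. They are matched with the
  compositions \<open>K\<close> for which \<open>\<Theta>\<^sub>K(a) > l\<close>, and the negative ones among the resulting terms are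
  absorbed by exchanging \<open>i\<^sub>1\<close> and \<open>j\<^sub>1\<close>.
\<close>

section \<open>Weighted walks on the complete graph\<close>

locale weighted_colours =
  fixes S :: "'c set" and x :: "'c \<Rightarrow> 'a::comm_ring_1"
  assumes finite_colours: "finite S"
begin

text \<open>Adjacency operator of the complete graph, with the weight on the colour stepped to. The
  colour \<open>r\<close> itself stays unweighted, so walks from a common vertex can be multiplied;
  \<open>ip\<close> supplies the weight of that vertex once.\<close>

definition step :: "('c \<Rightarrow> 'a) \<Rightarrow> 'c \<Rightarrow> 'a" where
  "step h r = (\<Sum>d\<in>S - {r}. x d * h d)"

definition ip :: "('c \<Rightarrow> 'a) \<Rightarrow> ('c \<Rightarrow> 'a) \<Rightarrow> 'a" where
  "ip h g = (\<Sum>r\<in>S. x r * h r * g r)"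

definition walk :: "nat \<Rightarrow> 'c \<Rightarrow> 'a" where
  "walk m = (step ^^ m) (\<lambda>_. 1)"

text \<open>Colourings of a cycle of length \<open>m + 1\<close> whose root has colour \<open>r\<close>, without the weight of the
  root.\<close>

definition closed_walk :: "nat \<Rightarrow> 'c \<Rightarrow> 'a" where
  "closed_walk m r = (step ^^ m) (\<lambda>c. if c = r then 0 else 1) r"

lemma walk_0: "walk 0 = (\<lambda>_. 1)"
  and walk_Suc: "walk (Suc m) = step (walk m)"
  by (simp_all add: walk_def)

text \<open>All colours but one are allowed, so \<open>step\<close> is a rank-one operator minus a
  diagonal one. The recursions below rest on this.\<close>

lemma step_eq: "r \<in> S \<Longrightarrow> step h r = ip h (\<lambda>_. 1) - x r * h r"
  by (simp add: step_def ip_def sum_diff1 finite_colours)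

lemma step_pow_diff:
  "(step ^^ m) (\<lambda>c. g c - y * h c) = (\<lambda>c. (step ^^ m) g c - y * (step ^^ m) h c)"
proof (induction m)
  case (Suc m)
  show ?case
    unfolding funpow.simps comp_def Suc
    by (rule ext) (simp add: step_def algebra_simps sum_subtractf sum_distrib_left)
qed simp

lemma closed_walk_0: "closed_walk 0 = (\<lambda>_. 0)"
  by (simp add: closed_walk_def fun_eq_iff)

text \<open>A walk of \<open>Suc m\<close> steps fails to close up exactly when it ends in
  \<open>r\<close>; dropping its last step then leaves a walk of \<open>m\<close> steps that does
  not end in \<open>r\<close>.\<close>

lemma closed_walk_Suc:
  assumes "r \<in> S"
  shows "closed_walk (Suc m) r = walk (Suc m) r - x r * closed_walk m r"
proof -
  let ?ne = "\<lambda>c. if c = r then 0 else 1"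
  have "step ?ne c = step (\<lambda>_. 1) c - x r * ?ne c" for c
  proof (cases "c = r")
    case False
    then have "step (\<lambda>_. 1) c = x r + (\<Sum>d\<in>S - {c} - {r}. x d)"
      using assms finite_colours by (simp add: step_def sum.remove [of _ r])
    moreover have "step ?ne c = (\<Sum>d\<in>S - {c} - {r}. x d)"
      using assms finite_colours False
      by (simp add: step_def sum.remove [of _ r])
    ultimately show ?thesis using False by simp
  qed (auto simp: step_def intro!: sum.cong)
  then have "step ?ne = (\<lambda>c. step (\<lambda>_. 1) c - x r * ?ne c)" by (rule ext)
  then show ?thesis
    by (simp add: closed_walk_def walk_def funpow_Suc_right step_pow_diff del: funpow.simps)
qed

lemma ip_commute: "ip h g = ip g h"
  by (simp add: ip_def algebra_simps)

text \<open>A product of two linear forms minus a diagonal form is symmetric in \<open>h\<close> and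
  \<open>g\<close>.\<close>

lemma ip_step: "ip (step h) g = ip h (step g)"
proof -
  have *: "ip (step h) g = ip h (\<lambda>_. 1) * ip g (\<lambda>_. 1) - (\<Sum>r\<in>S. x r * x r * h r * g r)" for h g
  proof -
    have "ip (step h) g = (\<Sum>r\<in>S. ip h (\<lambda>_. 1) * (x r * g r) - x r * x r * h r * g r)"
      unfolding ip_def [of "step h"] by (rule sum.cong) (simp_all add: step_eq algebra_simps)
    then show ?thesis
      by (simp add: sum_subtractf ip_def sum_distrib_left)
  qed
  show ?thesis
    unfolding ip_commute [of h "step g"] * by (simp add: mult_ac)
qed

lemma ip_step_pow: "ip ((step ^^ k) h) g = ip h ((step ^^ k) g)"
  by (induction k arbitrary: h) (simp_all add: ip_step funpow_swap1)

lemma step_pow_walk: "(step ^^ k) (walk m) = walk (k + m)"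
  by (simp add: walk_def funpow_add)

text \<open>The diagonal term \<open>x r * x r * h r * closed_walk m r\<close> arises both from
  shortening the cycle and from applying \<open>step\<close> to \<open>h\<close>. Eliminating it
  moves one step from the cycle to \<open>h\<close>.\<close>

lemma ip_closed_walk_Suc:
  "ip h (closed_walk (Suc m)) =
    ip (step h) (closed_walk m) + ip h (walk (Suc m))
      - ip h (\<lambda>_. 1) * ip (\<lambda>_. 1) (closed_walk m)"
proof -
  have "ip h (closed_walk (Suc m)) =
      (\<Sum>r\<in>S. x r * h r * walk (Suc m) r - x r * x r * h r * closed_walk m r)"
    unfolding ip_def by (rule sum.cong) (simp_all add: closed_walk_Suc algebra_simps)
  moreover have "ip (step h) (closed_walk m) =
      (\<Sum>r\<in>S. ip h (\<lambda>_. 1) * (x r * closed_walk m r) - x r * x r * h r * closed_walk m r)"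
    unfolding ip_def [of "step h"] by (rule sum.cong) (simp_all add: step_eq algebra_simps)
  ultimately show ?thesis
    by (simp add: sum_subtractf ip_def sum_distrib_left)
qed

text \<open>Each of the \<open>m\<close> rounds shortens the cycle by one vertex. By
  self-adjointness it contributes the same path term every time, and it leaves one product with a
  smaller cycle.\<close>

lemma ip_closed_walk:
  "ip h (closed_walk m) = of_nat m * ip h (walk m)
    - (\<Sum>i<m. ip h (walk (m - Suc i)) * ip (\<lambda>_. 1) (closed_walk i))"
proof (induction m arbitrary: h)
  case 0
  then show ?case by (simp add: closed_walk_0 ip_def)
next
  case (Suc m)
  have 1: "ip (step h) (walk k) = ip h (walk (Suc k))" for k
    by (simp add: ip_step walk_Suc)
  have 2: "(\<Sum>i<m. ip h (walk (Suc (m - Suc i))) * ip (\<lambda>_. 1) (closed_walk i)) =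
      (\<Sum>i<m. ip h (walk (m - i)) * ip (\<lambda>_. 1) (closed_walk i))"
    by (rule sum.cong) (simp_all add: Suc_diff_Suc)
  show ?case
    unfolding ip_closed_walk_Suc Suc [of "step h"] 1 2 by (simp add: walk_0 algebra_simps)
qed

section \<open>Elementary symmetric polynomials and the generating function of paths\<close>

definition esym :: "nat \<Rightarrow> 'a" where
  "esym k = fps_nth (\<Prod>r\<in>S. 1 + fps_const (x r) * fps_X) k"

lemma fps_const_prod: "fps_const (prod f A) = (\<Prod>i\<in>A. fps_const (f i :: 'a))"
  by (induction A rule: infinite_finite_induct) (simp_all flip: fps_const_mult)

lemma esym_eq: "esym k = (\<Sum>J | J \<subseteq> S \<and> card J = k. \<Prod>r\<in>J. x r)"
proof -
  have "(\<Prod>r\<in>S. 1 + fps_const (x r) * fps_X) =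
      (\<Sum>J\<in>Pow S. fps_const (\<Prod>r\<in>J. x r) * fps_X ^ card J)"
    using finite_colours
    by (subst add.commute, subst prod_add)
       (auto simp: prod.distrib fps_const_prod intro!: sum.cong)
  then have "esym k = (\<Sum>J\<in>Pow S. if card J = k then \<Prod>r\<in>J. x r else 0)"
    by (auto simp: esym_def fps_sum_nth intro!: sum.cong)
  also have "\<dots> = (\<Sum>J | J \<subseteq> S \<and> card J = k. \<Prod>r\<in>J. x r)"
    using finite_colours by (simp add: sum.If_cases Int_def)
  finally show ?thesis .
qed

text \<open>The chromatic symmetric polynomial of the path on \<open>n\<close> vertices; the value 1
  at 0 is the constant term required by \<open>path_sum_fps\<close>.\<close>

definition path_sum :: "nat \<Rightarrow> 'a" where
  "path_sum n = (if n = 0 then 1 else ip (\<lambda>_. 1) (walk (n - 1)))"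

text \<open>Let \<open>Q r\<close> be the series of walks from \<open>r\<close> and \<open>P\<close>
  that of paths. By \<open>step_eq\<close>, \<open>(1 + x r * t) * Q r = P\<close>, while
  \<open>P\<close> is 1 plus \<open>t\<close> times the sum of all \<open>x r * Q r\<close>.
  Multiplying by \<open>E\<close> clears the denominators and produces the derivative of
  \<open>E\<close>.\<close>

lemma path_sum_fps:
  defines "E \<equiv> Abs_fps esym"
  shows "Abs_fps path_sum * (E - fps_X * fps_deriv E) = E"
proof -
  let ?f = "\<lambda>r. 1 + fps_const (x r) * fps_X"
  let ?Q = "\<lambda>r. Abs_fps (\<lambda>m. walk m r)"
  let ?P = "Abs_fps path_sum"
  have E: "E = (\<Prod>r\<in>S. ?f r)"
    by (rule fps_ext) (simp add: E_def esym_def)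
  have Q: "?f r * ?Q r = ?P" if "r \<in> S" for r
  proof (rule fps_ext)
    fix m
    show "fps_nth (?f r * ?Q r) m = fps_nth ?P m"
      using that
      by (cases m)
         (simp_all add: algebra_simps path_sum_def walk_0 walk_Suc step_eq ip_commute [of "\<lambda>_. 1"])
  qed
  have P: "?P = 1 + fps_X * (\<Sum>r\<in>S. fps_const (x r) * ?Q r)"
  proof (rule fps_ext)
    fix m
    show "fps_nth ?P m = fps_nth (1 + fps_X * (\<Sum>r\<in>S. fps_const (x r) * ?Q r)) m"
      by (cases m) (simp_all add: path_sum_def ip_def fps_sum_nth)
  qed
  have deriv: "fps_deriv E = (\<Sum>r\<in>S. fps_const (x r) * (\<Prod>s\<in>S - {r}. ?f s))"
    unfolding E using finite_colours
  proof (induction S)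
    case (insert s T)
    have "(\<Prod>s\<in>insert s T - {r}. ?f s) = ?f s * (\<Prod>s\<in>T - {r}. ?f s)" if "r \<in> T" for r
      using insert that by (subst insert_Diff_if) auto
    then show ?case
      using insert
      by (simp add: sum_distrib_left sum.distrib algebra_simps cong: sum.cong)
  qed simp
  have "E * ?P = E + fps_X * (\<Sum>r\<in>S. fps_const (x r) * ((\<Prod>s\<in>S - {r}. ?f s) * (?f r * ?Q r)))"
  proof -
    have "E * ?Q r = (\<Prod>s\<in>S - {r}. ?f s) * (?f r * ?Q r)" if "r \<in> S" for r
      using that finite_colours by (simp add: E prod.remove mult.commute mult.left_commute)
    then have "(\<Sum>r\<in>S. fps_const (x r) * ((\<Prod>s\<in>S - {r}. ?f s) * (?f r * ?Q r))) =
        E * (\<Sum>r\<in>S. fps_const (x r) * ?Q r)"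
      unfolding sum_distrib_left by (intro sum.cong) (simp_all only: mult.left_commute [of E])
    then show ?thesis
      by (subst P) (simp add: algebra_simps)
  qed
  also have "\<dots> = E + fps_X * (\<Sum>r\<in>S. fps_const (x r) * ((\<Prod>s\<in>S - {r}. ?f s) * ?P))"
    using Q by (simp cong: sum.cong)
  also have "\<dots> = E + fps_X * fps_deriv E * ?P"
    by (simp add: deriv sum_distrib_left sum_distrib_right mult.assoc)
  finally show ?thesis
    by (simp add: algebra_simps)
qed

end

section \<open>Colourings as words\<close>

lemma cycle_edges_rotate1: "cycle_edges (rotate1 xs) = cycle_edges xs"
proof (cases "xs = []")
  case False
  let ?n = "length xs"
  let ?e = "\<lambda>i. {xs ! i, xs ! (Suc i mod ?n)}"
  \<comment> \<open>Adding 1 modulo the length maps the indices onto themselves, so reindexing by it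
    does not change the edge set.\<close>
  have shift: "{..<?n} = (\<lambda>i. Suc i mod ?n) ` {..<?n}"
  proof (intro equalityI subsetI)
    fix j assume "j \<in> {..<?n}"
    then have "j = Suc (if j = 0 then ?n - 1 else j - 1) mod ?n"
      "(if j = 0 then ?n - 1 else j - 1) < ?n" by auto
    then show "j \<in> (\<lambda>i. Suc i mod ?n) ` {..<?n}" by blast
  qed (use False in auto)
  have "?e ` {..<?n} = (\<lambda>i. ?e (Suc i mod ?n)) ` {..<?n}"
    by (subst shift) (simp only: image_image)
  moreover have "cycle_edges ys = (\<lambda>i. {ys ! i, ys ! (Suc i mod length ys)}) ` {..<length ys}"
    for ys :: "'a list"
    by (auto simp: cycle_edges_def)
  moreover have "(\<lambda>i. {rotate1 xs ! i, rotate1 xs ! (Suc i mod ?n)}) ` {..<?n} =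
      (\<lambda>i. ?e (Suc i mod ?n)) ` {..<?n}"
    using False by (intro image_cong) (simp_all add: nth_rotate1)
  ultimately show ?thesis by simp
qed simp

text \<open>Lets each cycle be listed from the vertex that it shares with the path.\<close>

lemma cycle_edges_rotate: "cycle_edges (rotate k xs) = cycle_edges xs"
  by (induction k) (simp_all add: cycle_edges_rotate1)

lemma proper_path_iff:
  "(\<forall>u v. {u, v} \<in> path_edges ps \<longrightarrow> \<kappa> u \<noteq> \<kappa> v) \<longleftrightarrow> distinct_adj (map \<kappa> ps)"
proof -
  have "(\<forall>u v. {u, v} \<in> path_edges ps \<longrightarrow> \<kappa> u \<noteq> \<kappa> v) \<longleftrightarrow>
      (\<forall>i. Suc i < length ps \<longrightarrow> \<kappa> (ps ! i) \<noteq> \<kappa> (ps ! Suc i))"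
    unfolding path_edges_def by (auto simp: doubleton_eq_iff)
  then show ?thesis
    by (auto simp: distinct_adj_conv_nth)
qed

lemma proper_cycle_iff:
  "(\<forall>u v. {u, v} \<in> cycle_edges (c # cs) \<longrightarrow> \<kappa> u \<noteq> \<kappa> v) \<longleftrightarrow>
    distinct_adj (map \<kappa> (c # cs)) \<and> last (map \<kappa> (c # cs)) \<noteq> \<kappa> c"
proof -
  let ?n = "length cs"
  have "(\<forall>u v. {u, v} \<in> cycle_edges (c # cs) \<longrightarrow> \<kappa> u \<noteq> \<kappa> v) \<longleftrightarrow>
      (\<forall>i\<le>?n. \<kappa> ((c # cs) ! i) \<noteq> \<kappa> ((c # cs) ! (Suc i mod Suc ?n)))"
    unfolding cycle_edges_def by (auto simp: doubleton_eq_iff less_Suc_eq_le)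
  \<comment> \<open>The index \<open>?n\<close> gives the closing edge, because its successor is 0
    modulo the length.\<close>
  also have "\<dots> \<longleftrightarrow> (\<forall>i<?n. \<kappa> ((c # cs) ! i) \<noteq> \<kappa> ((c # cs) ! Suc i))
      \<and> \<kappa> ((c # cs) ! ?n) \<noteq> \<kappa> c"
    by (auto simp: le_less)
  also have "\<dots> \<longleftrightarrow> distinct_adj (map \<kappa> (c # cs)) \<and> last (map \<kappa> (c # cs)) \<noteq> \<kappa> c"
    by (simp add: distinct_adj_conv_nth last_conv_nth del: list.map(2) nth_Cons_Suc)
  finally show ?thesis .
qed

section \<open>Walks and colourings as sums over words\<close>

context weighted_colours
begin

definition words :: "nat \<Rightarrow> 'c list set" where
  "words m = {w. set w \<subseteq> S \<and> length w = m}"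

definition word_weight :: "'c list \<Rightarrow> 'a" where
  "word_weight w = prod_list (map x w)"

lemma word_weight_simps [simp]:
  "word_weight [] = 1" "word_weight (c # w) = x c * word_weight w"
  "word_weight (v @ w) = word_weight v * word_weight w"
  by (simp_all add: word_weight_def)

lemma words_0: "words 0 = {[]}"
  by (auto simp: words_def)

lemma sum_words_append:
  "(\<Sum>w\<in>words (m + k). f w) = (\<Sum>u\<in>words m. \<Sum>v\<in>words k. f (u @ v))"
proof -
  have "(\<Sum>w\<in>words (m + k). f w) = (\<Sum>(u, v)\<in>words m \<times> words k. f (u @ v))"
    by (rule sum.reindex_bij_witness [where i = "\<lambda>(u, v). u @ v" and j = "\<lambda>w. (take m w, drop m w)"])
       (auto simp: words_def dest: in_set_takeD in_set_dropD)
  then show ?thesis by (simp add: sum.cartesian_product)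
qed

lemma sum_words_1: "(\<Sum>w\<in>words (Suc 0). f w) = (\<Sum>c\<in>S. f [c])"
  by (rule sum.reindex_bij_witness [where i = "\<lambda>c. [c]" and j = hd])
     (auto simp: words_def length_Suc_conv)

lemma step_pow_words:
  "(step ^^ m) h r =
    (\<Sum>w\<in>words m. of_bool (distinct_adj (r # w)) * word_weight w * h (last (r # w)))"
proof (induction m arbitrary: r)
  case 0
  then show ?case by (simp add: words_0)
next
  case (Suc m)
  have "(step ^^ Suc m) h r = (\<Sum>d\<in>S - {r}. x d * (\<Sum>w\<in>words m.
      of_bool (distinct_adj (d # w)) * word_weight w * h (last (d # w))))"
    by (simp add: step_def Suc)
  also have "\<dots> = (\<Sum>d\<in>S. of_bool (r \<noteq> d) * (x d * (\<Sum>w\<in>words m.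
      of_bool (distinct_adj (d # w)) * word_weight w * h (last (d # w)))))"
    by (rule sum.mono_neutral_cong_left) (auto simp: finite_colours)
  also have "\<dots> = (\<Sum>d\<in>S. \<Sum>w\<in>words m. of_bool (distinct_adj (r # d # w))
      * word_weight (d # w) * h (last (r # d # w)))"
    by (simp add: sum_distrib_left of_bool_conj mult_ac)
  also have "\<dots> = (\<Sum>w\<in>words (Suc m). of_bool (distinct_adj (r # w)) * word_weight w * h (last (r # w)))"
    using sum_words_append [of "\<lambda>w. of_bool (distinct_adj (r # w)) * word_weight w * h (last (r # w))"
        "Suc 0" m]
    by (simp add: sum_words_1)
  finally show ?case .
qed

lemma closed_walk_words:
  "closed_walk m r =
    (\<Sum>w\<in>words m. of_bool (distinct_adj (r # w) \<and> last (r # w) \<noteq> r) * word_weight w)"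
  unfolding closed_walk_def step_pow_words by (rule sum.cong) auto

lemma sum_colourings_words:
  assumes "distinct zs"
  shows "(\<Sum>\<kappa>\<in>set zs \<rightarrow>\<^sub>E S. f (map \<kappa> zs)) = (\<Sum>w\<in>words (length zs). f w)"
proof (rule sum.reindex_bij_witness [where
      i = "\<lambda>w. \<lambda>v\<in>set zs. the (map_of (zip zs w) v)" and j = "\<lambda>\<kappa>. map \<kappa> zs"])
  fix \<kappa> assume \<kappa>: "\<kappa> \<in> set zs \<rightarrow>\<^sub>E S"
  show "(\<lambda>v\<in>set zs. the (map_of (zip zs (map \<kappa> zs)) v)) = \<kappa>"
    by (rule extensionalityI [OF restrict_extensional])
       (use \<kappa> in \<open>simp_all add: map_of_zip_map PiE_def\<close>)
  show "map \<kappa> zs \<in> words (length zs)"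
    using \<kappa> by (auto simp: words_def)
next
  fix w assume w: "w \<in> words (length zs)"
  have nth: "the (map_of (zip zs w) (zs ! i)) = w ! i" if "i < length zs" for i
    using w that assms by (simp add: words_def map_of_zip_nth)
  show "map (\<lambda>v\<in>set zs. the (map_of (zip zs w) v)) zs = w"
    using w nth by (intro nth_equalityI) (simp_all add: words_def)
  show "(\<lambda>v\<in>set zs. the (map_of (zip zs w) v)) \<in> set zs \<rightarrow>\<^sub>E S"
    unfolding restrict_PiE_iff
  proof
    fix v assume "v \<in> set zs"
    then obtain i where "i < length zs" "v = zs ! i" by (auto simp: in_set_conv_nth)
    then show "the (map_of (zip zs w) v) \<in> S"
      using w nth by (auto simp: words_def)
  qed
qed simp

text \<open>List the path first, then each cycle without its attaching vertex. A proper colouring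
  becomes a walk of \<open>l\<close> steps with a closed walk at each end.\<close>

lemma kayak_colourings:
  assumes "kayak_paddle a b l V E"
  shows "(\<Sum>\<kappa>\<in>V \<rightarrow>\<^sub>E S. of_bool (\<forall>u v. {u, v} \<in> E \<longrightarrow> \<kappa> u \<noteq> \<kappa> v) * (\<Prod>v\<in>V. x (\<kappa> v))) =
    ip (closed_walk (a - 1)) ((step ^^ l) (closed_walk (b - 1)))"
proof -
  obtain us vs ps where k: "distinct us" "length us = a" "distinct vs" "length vs = b"
    "distinct ps" "length ps = l + 1" "set us \<inter> set ps = {hd ps}" "set vs \<inter> set ps = {last ps}"
    "set us \<inter> set vs = (if l = 0 then {hd ps} else {})"
    "V = set us \<union> set ps \<union> set vs"
    "E = cycle_edges us \<union> path_edges ps \<union> cycle_edges vs"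
    using assms unfolding kayak_paddle_def by blast
  have rot: "\<exists>D. cycle_edges (c # D) = cycle_edges cs \<and> distinct (c # D) \<and> set cs = set (c # D)
      \<and> length cs = Suc (length D)" if c: "c \<in> set cs" "distinct cs" for c :: 'b and cs
  proof -
    obtain A B where AB: "cs = A @ c # B" using split_list [OF c(1)] by blast
    then have "c # B @ A = rotate (length A) cs" by (simp add: rotate_append)
    then have "cycle_edges (c # B @ A) = cycle_edges cs" by (simp add: cycle_edges_rotate)
    then show ?thesis using AB c(2) by (intro exI [of _ "B @ A"]) auto
  qed
  obtain U where U: "cycle_edges (hd ps # U) = cycle_edges us" "distinct (hd ps # U)"
    "set us = set (hd ps # U)" "a = Suc (length U)"
    using rot [of "hd ps" us] k by auto
  obtain W where W: "cycle_edges (last ps # W) = cycle_edges vs" "distinct (last ps # W)"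
    "set vs = set (last ps # W)" "b = Suc (length W)"
    using rot [of "last ps" vs] k by auto
  have "ps \<noteq> []" using k by auto
  then have ends: "hd ps \<in> set ps" "last ps \<in> set ps" by auto
  let ?zs = "ps @ U @ W"
  have V: "V = set ?zs" using k U W ends by auto
  \<comment> \<open>For \<open>l = 0\<close> the cycles meet, but only in \<open>hd ps\<close>,
    which \<open>U\<close> omits.\<close>
  have "set U \<inter> set W = {}"
  proof -
    have "set us \<inter> set vs \<subseteq> {hd ps}" using k(9) by simp
    then show ?thesis using U(2,3) W(3) by auto
  qed
  then have dist: "distinct ?zs"
    using k U W ends by auto
  let ?p = "length U" and ?q = "length W"
  define closed where "closed = (\<lambda>(r :: 'c) w. distinct_adj (r # w) \<and> last (r # w) \<noteq> r)"
  \<comment> \<open>The first \<open>l + 1\<close> letters colour the path, the next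
    \<open>?p\<close> the first cycle and the rest the second; the attaching vertices have the
    colours \<open>hd w\<close> and \<open>last (take (l + 1) w)\<close>.\<close>
  define Q where "Q = (\<lambda>w. distinct_adj (take (l + 1) w)
      \<and> closed (hd w) (take ?p (drop (l + 1) w)) \<and> closed (last (take (l + 1) w)) (drop (l + 1 + ?p) w))"
  have prod: "(\<Prod>v\<in>V. x (\<kappa> v)) = word_weight (map \<kappa> ?zs)" for \<kappa>
    unfolding V word_weight_def prod.distinct_set_conv_list [OF dist] map_map comp_def ..
  have proper: "(\<forall>u v. {u, v} \<in> E \<longrightarrow> \<kappa> u \<noteq> \<kappa> v) \<longleftrightarrow> Q (map \<kappa> ?zs)" for \<kappa>
  proof -
    have "(\<forall>u v. {u, v} \<in> E \<longrightarrow> \<kappa> u \<noteq> \<kappa> v) \<longleftrightarrow> distinct_adj (map \<kappa> ps)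
        \<and> (\<forall>u v. {u, v} \<in> cycle_edges (hd ps # U) \<longrightarrow> \<kappa> u \<noteq> \<kappa> v)
        \<and> (\<forall>u v. {u, v} \<in> cycle_edges (last ps # W) \<longrightarrow> \<kappa> u \<noteq> \<kappa> v)"
      unfolding k(11) U(1) W(1) proper_path_iff [symmetric] by blast
    then show ?thesis
      unfolding proper_cycle_iff using k(6) \<open>ps \<noteq> []\<close>
      by (simp add: Q_def closed_def hd_append hd_map last_map)
  qed
  have "(\<Sum>\<kappa>\<in>V \<rightarrow>\<^sub>E S. of_bool (\<forall>u v. {u, v} \<in> E \<longrightarrow> \<kappa> u \<noteq> \<kappa> v) * (\<Prod>v\<in>V. x (\<kappa> v))) =
      (\<Sum>w\<in>words (Suc 0 + (l + (?p + ?q))). of_bool (Q w) * word_weight w)"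
    unfolding prod proper unfolding V
    using sum_colourings_words [OF dist, of "\<lambda>w. of_bool (Q w) * word_weight w"] k(6)
    by simp
  \<comment> \<open>The first letter is split off: it is the colour over which \<open>ip\<close>
    sums.\<close>
  also have "\<dots> = (\<Sum>r\<in>S. \<Sum>w\<in>words l. \<Sum>u\<in>words ?p. \<Sum>v\<in>words ?q.
      of_bool (Q (r # w @ u @ v)) * word_weight (r # w @ u @ v))"
    unfolding sum_words_append sum_words_1 by simp
  also have "\<dots> = (\<Sum>r\<in>S. x r * closed_walk ?p r * (step ^^ l) (closed_walk ?q) r)"
  proof (rule sum.cong)
    fix r assume "r \<in> S"
    have "of_bool (Q (r # w @ u @ v)) * word_weight (r # w @ u @ v) =
        of_bool (distinct_adj (r # w)) * word_weight w * (x r * (of_bool (closed r u) * word_weight u)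
          * (of_bool (closed (last (r # w)) v) * word_weight v))"
      if "w \<in> words l" "u \<in> words ?p" "v \<in> words ?q" for w u v
      using that by (simp add: Q_def words_def of_bool_conj mult_ac)
    then have "(\<Sum>w\<in>words l. \<Sum>u\<in>words ?p. \<Sum>v\<in>words ?q.
        of_bool (Q (r # w @ u @ v)) * word_weight (r # w @ u @ v)) =
      (\<Sum>w\<in>words l. \<Sum>u\<in>words ?p. \<Sum>v\<in>words ?q.
        of_bool (distinct_adj (r # w)) * word_weight w * (x r * (of_bool (closed r u) * word_weight u)
          * (of_bool (closed (last (r # w)) v) * word_weight v)))"
      by (intro sum.cong refl)
    also have "\<dots> = (\<Sum>w\<in>words l. of_bool (distinct_adj (r # w)) * word_weight w
        * (x r * closed_walk ?p r * closed_walk ?q (last (r # w))))"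
    proof (rule sum.cong)
      fix w
      have "x r * closed_walk ?p r * closed_walk ?q c = (\<Sum>u\<in>words ?p. \<Sum>v\<in>words ?q.
          x r * (of_bool (closed r u) * word_weight u) * (of_bool (closed c v) * word_weight v))" for c
        unfolding closed_walk_words closed_def sum_distrib_left [of "x r"] sum_product ..
      then show "(\<Sum>u\<in>words ?p. \<Sum>v\<in>words ?q.
          of_bool (distinct_adj (r # w)) * word_weight w * (x r * (of_bool (closed r u) * word_weight u)
            * (of_bool (closed (last (r # w)) v) * word_weight v))) =
          of_bool (distinct_adj (r # w)) * word_weight w
            * (x r * closed_walk ?p r * closed_walk ?q (last (r # w)))"
        by (simp only: sum_distrib_left)
    qed simp
    also have "\<dots> = x r * closed_walk ?p r * (step ^^ l) (closed_walk ?q) r"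
      unfolding step_pow_words [of l] sum_distrib_left by (simp add: mult_ac)
    finally show "(\<Sum>w\<in>words l. \<Sum>u\<in>words ?p. \<Sum>v\<in>words ?q.
        of_bool (Q (r # w @ u @ v)) * word_weight (r # w @ u @ v)) =
      x r * closed_walk ?p r * (step ^^ l) (closed_walk ?q) r" .
  qed simp
  finally show ?thesis
    using U(4) W(4) by (simp add: ip_def)
qed

end

section \<open>Compositions and their partial sums\<close>

lemma compositions_Nil_iff: "[] \<in> compositions n \<longleftrightarrow> n = 0"
  by (auto simp: compositions_def)

lemma compositions_Cons_iff:
  "k # K \<in> compositions n \<longleftrightarrow> 1 \<le> k \<and> k \<le> n \<and> K \<in> compositions (n - k)"
  by (auto simp: compositions_def)

lemma compositions_append_iff:
  "I @ J \<in> compositions n \<longleftrightarrow>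
    sum_list I \<le> n \<and> I \<in> compositions (sum_list I) \<and> J \<in> compositions (n - sum_list I)"
  by (auto simp: compositions_def)

lemma compositions_0: "compositions 0 = {[]}"
proof -
  have "K = []" if "K \<in> compositions 0" for K
    using that by (cases K) (auto simp: compositions_def)
  then show ?thesis by (auto simp: compositions_Nil_iff)
qed

lemma sum_compositions_Cons:
  assumes "n \<ge> 1"
  shows "(\<Sum>K\<in>compositions n. f K) = (\<Sum>k=1..n. \<Sum>K\<in>compositions (n - k). f (k # K))"
proof -
  have "(\<Sum>K\<in>compositions n. f K) =
      (\<Sum>(k, K)\<in>(SIGMA k:{1..n}. compositions (n - k)). f (k # K))"
  proof (rule sum.reindex_bij_witness [where i = "\<lambda>(k, K). k # K" and j = "\<lambda>K. (hd K, tl K)"])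
    fix K assume K: "K \<in> compositions n"
    with assms obtain k L where "K = k # L"
      by (cases K) (auto simp: compositions_Nil_iff)
    with K show "(case (hd K, tl K) of (k, K) \<Rightarrow> k # K) = K"
      and "(hd K, tl K) \<in> (SIGMA k:{1..n}. compositions (n - k))"
      and "(case (hd K, tl K) of (k, K) \<Rightarrow> f (k # K)) = f K"
      by (simp_all add: compositions_Cons_iff)
  qed (auto simp: compositions_Cons_iff)
  then show ?thesis
    by (simp add: sum.Sigma finite_compositions)
qed

section \<open>Partial sums and the behaviour of \<open>Theta_up\<close> and
  \<open>sigma_down\<close>\<close>

lemma finite_partial_sums: "finite (partial_sums K)"
  by (simp add: partial_sums_def finite_image_set)

lemma zero_in_partial_sums: "0 \<in> partial_sums K"
  unfolding partial_sums_def by (rule CollectI, rule exI [of _ 0]) simp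

lemma sum_list_in_partial_sums: "sum_list K \<in> partial_sums K"
  unfolding partial_sums_def by (rule CollectI, rule exI [of _ "length K"]) simp

lemma partial_sums_iff: "s \<in> partial_sums K \<longleftrightarrow> (\<exists>I J. K = I @ J \<and> s = sum_list I)"
proof
  assume "s \<in> partial_sums K"
  then obtain j where "s = sum_list (take j K)" by (auto simp: partial_sums_def)
  then have "K = take j K @ drop j K \<and> s = sum_list (take j K)" by simp
  then show "\<exists>I J. K = I @ J \<and> s = sum_list I" by blast
next
  assume "\<exists>I J. K = I @ J \<and> s = sum_list I"
  then obtain I J where "K = I @ J" "s = sum_list I" by blast
  then show "s \<in> partial_sums K"
    unfolding partial_sums_def by (intro CollectI exI [of _ "length I"]) simp
qed

lemma partial_sums_Nil: "partial_sums [] = {0}"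
  by (auto simp: partial_sums_iff)

lemma partial_sums_Cons: "partial_sums (k # K) = insert 0 ((+) k ` partial_sums K)"
proof (intro equalityI subsetI)
  fix s assume "s \<in> partial_sums (k # K)"
  then obtain I J where IJ: "k # K = I @ J" "s = sum_list I"
    by (auto simp: partial_sums_iff)
  show "s \<in> insert 0 ((+) k ` partial_sums K)"
  proof (cases I)
    case (Cons i I')
    with IJ have "sum_list I' \<in> partial_sums K" by (auto simp: partial_sums_iff)
    then show ?thesis using IJ Cons by simp
  qed (use IJ in simp)
next
  fix s assume "s \<in> insert 0 ((+) k ` partial_sums K)"
  then show "s \<in> partial_sums (k # K)"
  proof
    assume "s \<in> (+) k ` partial_sums K"
    then obtain I J where "k # K = (k # I) @ J" "s = sum_list (k # I)"
      by (auto simp: partial_sums_iff)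
    then show ?thesis unfolding partial_sums_iff by blast
  qed (simp add: zero_in_partial_sums)
qed

lemma partial_sums_append:
  "partial_sums (I @ J) = partial_sums I \<union> (+) (sum_list I) ` partial_sums J"
proof (induction I)
  case (Cons k I)
  then show ?case by (simp add: partial_sums_Cons image_Un image_image add.assoc)
qed (use zero_in_partial_sums in \<open>auto simp: partial_sums_Nil\<close>)

lemma partial_sums_le: "s \<in> partial_sums K \<Longrightarrow> s \<le> sum_list K"
  by (auto simp: partial_sums_iff)

lemma sigma_up_eqI:
  assumes "s \<in> partial_sums K" "c \<le> s" "\<And>t. t \<in> partial_sums K \<Longrightarrow> c \<le> t \<Longrightarrow> s \<le> t"
  shows "sigma_up K c = s"
  unfolding sigma_up_def by (rule Min_eqI) (use assms finite_partial_sums in auto)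

lemma sigma_up_props:
  assumes "c \<le> sum_list K"
  shows "sigma_up K c \<in> partial_sums K" "c \<le> sigma_up K c"
    and "\<And>t. t \<in> partial_sums K \<Longrightarrow> c \<le> t \<Longrightarrow> sigma_up K c \<le> t"
proof -
  have "{s \<in> partial_sums K. c \<le> s} \<noteq> {}"
    using assms sum_list_in_partial_sums by blast
  then have "sigma_up K c \<in> {s \<in> partial_sums K. c \<le> s}"
    unfolding sigma_up_def by (intro Min_in) (simp_all add: finite_partial_sums)
  then show "sigma_up K c \<in> partial_sums K" "c \<le> sigma_up K c" by auto
  show "\<And>t. t \<in> partial_sums K \<Longrightarrow> c \<le> t \<Longrightarrow> sigma_up K c \<le> t"
    unfolding sigma_up_def by (rule Min_le) (simp_all add: finite_partial_sums)
qed

lemma sigma_down_eqI: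
  assumes "s \<in> partial_sums K" "s \<le> c" "\<And>t. t \<in> partial_sums K \<Longrightarrow> t \<le> c \<Longrightarrow> t \<le> s"
  shows "sigma_down K c = s"
  unfolding sigma_down_def by (rule Max_eqI) (use assms finite_partial_sums in auto)

lemma sigma_down_props:
  shows "sigma_down K c \<in> partial_sums K" "sigma_down K c \<le> c"
    and "\<And>t. t \<in> partial_sums K \<Longrightarrow> t \<le> c \<Longrightarrow> t \<le> sigma_down K c"
proof -
  have "{s \<in> partial_sums K. s \<le> c} \<noteq> {}"
    using zero_in_partial_sums by blast
  then have "sigma_down K c \<in> {s \<in> partial_sums K. s \<le> c}"
    unfolding sigma_down_def by (intro Max_in) (simp_all add: finite_partial_sums)
  then show "sigma_down K c \<in> partial_sums K" "sigma_down K c \<le> c" by auto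
  show "\<And>t. t \<in> partial_sums K \<Longrightarrow> t \<le> c \<Longrightarrow> t \<le> sigma_down K c"
    unfolding sigma_down_def by (rule Max_ge) (simp_all add: finite_partial_sums)
qed

text \<open>A prefix that ends at or before \<open>c\<close> only shifts the origin.\<close>

lemma Theta_up_append:
  assumes "sum_list I \<le> c" "c \<le> sum_list (I @ J)"
  shows "Theta_up (I @ J) c = Theta_up J (c - sum_list I)"
proof -
  have J: "c - sum_list I \<le> sum_list J" using assms by simp
  have "sigma_up (I @ J) c = sum_list I + sigma_up J (c - sum_list I)"
  proof (rule sigma_up_eqI)
    fix t assume t: "t \<in> partial_sums (I @ J)" "c \<le> t"
    \<comment> \<open>A partial sum of \<open>I\<close> that is at least \<open>c\<close> equals
      \<open>sum_list I\<close>, which is the case \<open>u = 0\<close>.\<close>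
    then obtain u where "u \<in> partial_sums J" "t = sum_list I + u"
      using assms(1) partial_sums_le [of t I] zero_in_partial_sums [of J]
      by (force simp: partial_sums_append)
    with t show "sum_list I + sigma_up J (c - sum_list I) \<le> t"
      using sigma_up_props(3) [OF J] by simp
  qed (use sigma_up_props [OF J] in \<open>auto simp: partial_sums_append\<close>)
  then show ?thesis using assms(1) by (simp add: Theta_up_def)
qed

lemma Theta_up_first:
  assumes "0 < c" "c \<le> k"
  shows "Theta_up (k # K) c = k - c"
proof -
  have "sigma_up (k # K) c = k"
    by (rule sigma_up_eqI) (use assms zero_in_partial_sums in \<open>auto simp: partial_sums_Cons\<close>)
  then show ?thesis by (simp add: Theta_up_def)
qed

lemma Theta_up_0: "Theta_up K 0 = 0"
proof -
  have "sigma_up K 0 = 0" by (rule sigma_up_eqI) (simp_all add: zero_in_partial_sums)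
  then show ?thesis by (simp add: Theta_up_def)
qed

lemma Theta_up_step:
  assumes "c < sum_list K" "c \<notin> partial_sums K"
  shows "Theta_up K c = Suc (Theta_up K (Suc c))"
proof -
  have ne: "sigma_up K c \<noteq> c"
    using sigma_up_props(1) [of c K] assms by auto
  have "sigma_up K (Suc c) = sigma_up K c"
    by (rule sigma_up_eqI) (use sigma_up_props [of c K] ne assms in auto)
  then show ?thesis
    using sigma_up_props(2) [of c K] ne assms by (simp add: Theta_up_def)
qed

lemma sigma_down_Cons:
  assumes "k \<le> c"
  shows "sigma_down (k # K) c = k + sigma_down K (c - k)"
  by (rule sigma_down_eqI)
     (use assms sigma_down_props [where K = K and c = "c - k"] in \<open>auto simp: partial_sums_Cons le_diff_conv2\<close>)

lemma sigma_down_append: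
  assumes "sum_list I \<le> c" "c < sum_list I + hd J" "J \<noteq> []"
  shows "sigma_down (I @ J) c = sum_list I"
proof (rule sigma_down_eqI)
  fix t assume t: "t \<in> partial_sums (I @ J)" "t \<le> c"
  obtain j J' where J: "J = j # J'" using assms(3) by (cases J) auto
  from t show "t \<le> sum_list I"
    using assms by (auto simp: J partial_sums_append partial_sums_Cons dest: partial_sums_le)
qed (use assms sum_list_in_partial_sums [of I] in \<open>auto simp: partial_sums_append\<close>)

lemma sum_compositions_split:
  assumes "c \<le> n"
  shows "(\<Sum>K | K \<in> compositions n \<and> c \<in> partial_sums K. f K) =
    (\<Sum>I\<in>compositions c. \<Sum>J\<in>compositions (n - c). f (I @ J))"
proof -
  have "(\<Sum>K | K \<in> compositions n \<and> c \<in> partial_sums K. f K) =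
      sum f ((\<lambda>(I, J). I @ J) ` (compositions c \<times> compositions (n - c)))"
  proof (rule sum.cong)
    show "{K \<in> compositions n. c \<in> partial_sums K} =
        (\<lambda>(I, J). I @ J) ` (compositions c \<times> compositions (n - c))"
      using assms by (fastforce simp: partial_sums_iff compositions_def image_iff)
  qed simp
  also have "\<dots> = (\<Sum>(I, J)\<in>compositions c \<times> compositions (n - c). f (I @ J))"
  proof (subst sum.reindex)
    show "inj_on (\<lambda>(I, J). I @ J) (compositions c \<times> compositions (n - c))"
    proof (rule inj_onI, clarify)
      fix I J I' J' :: "nat list"
      assume *: "I \<in> compositions c" "J \<in> compositions (n - c)"
        "I' \<in> compositions c" "J' \<in> compositions (n - c)" "I @ J = I' @ J'"
      then obtain L where L: "I = I' @ L \<and> L @ J = J' \<or> I @ L = I' \<and> J = L @ J'"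
        unfolding append_eq_append_conv2 by blast
      \<comment> \<open>Two prefixes with the same sum differ by positive parts of total zero, hence
        not at all.\<close>
      then have "sum_list L = 0 \<and> (\<forall>k\<in>set L. k \<ge> 1)"
      proof
        assume "I = I' @ L \<and> L @ J = J'"
        with *(1,3) show ?thesis by (simp add: compositions_def)
      next
        assume "I @ L = I' \<and> J = L @ J'"
        with *(1,3) show ?thesis by (auto simp: compositions_def)
      qed
      then have "L = []" by (cases L) auto
      with L show "I = I' \<and> J = J'" by simp
    qed
  qed (simp add: case_prod_unfold)
  finally show ?thesis by (simp add: sum.cartesian_product)
qed

text \<open>The first part of \<open>J\<close> has factor \<open>hd J\<close> in the weight of
  \<open>J\<close>, but \<open>hd J - 1\<close> once \<open>I\<close> precedes it.\<close>

lemma comp_weight_append: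
  assumes "I \<noteq> []" "J \<noteq> []"
  shows "hd J * comp_weight (I @ J) = (hd J - 1) * comp_weight I * comp_weight J"
  using assms by (cases J) (auto simp: comp_weight_def)

definition part_prod :: "nat list \<Rightarrow> nat" where
  "part_prod K = prod_list (map (\<lambda>k. k - 1) K)"

lemma comp_weight_Cons: "comp_weight (k # K) = k * part_prod K"
  by (simp add: comp_weight_def part_prod_def)

lemma part_prod_simps [simp]:
  "part_prod [] = 1" "part_prod (k # K) = (k - 1) * part_prod K"
  "part_prod (I @ J) = part_prod I * part_prod J" "part_prod (rev K) = part_prod K"
  by (simp_all add: part_prod_def rev_map [symmetric])

lemma part_prod_eq_0: "1 \<in> set K \<Longrightarrow> part_prod K = 0"
  by (force simp: part_prod_def prod_list_zero_iff)

text \<open>Partial sums grow, so the admissible prefixes form an initial run, and their last parts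
  add up to the sum of the longest one.\<close>

lemma sum_last_parts:
  "(\<Sum>i | 1 \<le> i \<and> i \<le> length L \<and> sum_list (take i L) \<le> m. L ! (i - 1)) = sigma_down L m"
proof (induction L arbitrary: m)
  case Nil
  have "sigma_down [] m = 0"
    by (rule sigma_down_eqI) (auto simp: partial_sums_Nil)
  then show ?case by simp
next
  case (Cons k L)
  show ?case
  proof (cases "k \<le> m")
    case True
    let ?A = "{i. 1 \<le> i \<and> i \<le> length L \<and> sum_list (take i L) \<le> m - k}"
    have "{i. 1 \<le> i \<and> i \<le> length (k # L) \<and> sum_list (take i (k # L)) \<le> m} = insert 1 (Suc ` ?A)"
    proof (intro set_eqI)
      fix i
      show "i \<in> {i. 1 \<le> i \<and> i \<le> length (k # L) \<and> sum_list (take i (k # L)) \<le> m} \<longleftrightarrow>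
          i \<in> insert 1 (Suc ` ?A)"
        using True by (cases i; cases "i - 1") (auto simp: image_iff)
    qed
    moreover have "(\<Sum>i\<in>insert 1 (Suc ` ?A). (k # L) ! (i - 1)) = k + (\<Sum>i\<in>?A. L ! (i - 1))"
      by (subst sum.insert) (auto simp: sum.reindex nth_Cons' intro!: sum.cong)
    ultimately show ?thesis
      using Cons True by (simp add: sigma_down_Cons)
  next
    case False
    then have "{i. 1 \<le> i \<and> i \<le> length (k # L) \<and> sum_list (take i (k # L)) \<le> m} = {}"
      by (auto simp: take_Cons' )
    moreover have "sigma_down (k # L) m = 0"
      by (rule sigma_down_eqI) (use False in \<open>auto simp: partial_sums_Cons\<close>)
    ultimately show ?thesis by (simp only: sum.empty)
  qed
qed

section \<open>Expansion in elementary symmetric functions\<close>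

context weighted_colours
begin

definition esym_comp :: "nat list \<Rightarrow> 'a" where
  "esym_comp K = prod_list (map esym K)"

lemma esym_comp_simps [simp]:
  "esym_comp [] = 1" "esym_comp (k # K) = esym k * esym_comp K"
  "esym_comp (I @ J) = esym_comp I * esym_comp J"
  by (simp_all add: esym_comp_def)

text \<open>With \<open>F = E - t * E'\<close>, the path series is
  \<open>E / F = 1 + t * E' / F\<close>. Beyond the constant term \<open>F\<close> has coefficients
  \<open>-(k - 1) * esym k\<close>, so \<open>1 / F\<close> runs over compositions with weight
  \<open>part_prod\<close>; \<open>t * E'\<close> supplies the first part with factor
  \<open>k\<close>.\<close>

lemma path_sum_expansion:
  assumes "n \<ge> 1"
  shows "path_sum n = (\<Sum>K\<in>compositions n. of_nat (comp_weight K) * esym_comp K)"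
proof -
  define A where "A = (\<lambda>n. \<Sum>K\<in>compositions n. of_nat (part_prod K) * esym_comp K)"
  let ?E = "Abs_fps esym"
  let ?F = "?E - fps_X * fps_deriv ?E"
  have esym_0: "esym 0 = 1"
  proof -
    have "{J. J \<subseteq> S \<and> card J = 0} = {{}}"
      using finite_colours finite_subset by fastforce
    then show ?thesis by (simp add: esym_eq)
  qed
  have A_0: "A 0 = 1"
    by (simp add: A_def compositions_0)
  have A_rec: "A n = (\<Sum>k=1..n. of_nat (k - 1) * esym k * A (n - k))" if "n \<ge> 1" for n
    unfolding A_def sum_compositions_Cons [OF that] sum_distrib_left
    by (simp add: mult_ac)
  have F_nth: "fps_nth ?F k = (if k = 0 then 1 else - of_nat (k - 1) * esym k)" for k
    using esym_0 by (cases k) (simp_all add: algebra_simps)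
  \<comment> \<open>\<open>A\<close> inverts \<open>?F\<close>: the recursion \<open>A_rec\<close>
    cancels every coefficient but the constant one.\<close>
  have "?F * Abs_fps A = 1"
  proof (rule fps_ext)
    fix n
    have "fps_nth (?F * Abs_fps A) n =
        (\<Sum>k=0..n. (if k = 0 then 1 else - of_nat (k - 1) * esym k) * A (n - k))"
      by (simp only: fps_mult_nth F_nth fps_nth_Abs_fps)
    also have "\<dots> = A n + (\<Sum>k=1..n. - (of_nat (k - 1) * esym k * A (n - k)))"
      by (subst sum.atLeast_Suc_atMost) (auto simp: algebra_simps intro!: sum.cong)
    also have "\<dots> = fps_nth 1 n"
    proof (cases "n = 0")
      case False
      then have "n \<ge> 1" by simp
      then show ?thesis
        unfolding sum_negf A_rec [OF \<open>n \<ge> 1\<close>, symmetric] by simp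
    qed (simp add: A_0)
    finally show "fps_nth (?F * Abs_fps A) n = fps_nth 1 n" .
  qed
  then have "Abs_fps path_sum = ?E * Abs_fps A"
    by (metis path_sum_fps mult.assoc mult.right_neutral)
  also have "?E = ?F + fps_X * fps_deriv ?E"
    by simp
  also have "\<dots> * Abs_fps A = 1 + fps_X * fps_deriv ?E * Abs_fps A"
    unfolding distrib_right \<open>?F * Abs_fps A = 1\<close> ..
  finally have "path_sum n = fps_nth (1 + fps_X * fps_deriv ?E * Abs_fps A) n"
    by (metis fps_nth_Abs_fps)
  also have "\<dots> = (\<Sum>k=0..n. of_nat k * esym k * A (n - k))"
  proof -
    have "fps_nth (fps_X * fps_deriv ?E) k = of_nat k * esym k" for k
      by (cases k) simp_all
    then have "fps_nth (fps_X * fps_deriv ?E * Abs_fps A) n = (\<Sum>k=0..n. of_nat k * esym k * A (n - k))"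
      by (simp only: fps_mult_nth fps_nth_Abs_fps)
    then show ?thesis using assms by simp
  qed
  also have "\<dots> = (\<Sum>k=1..n. of_nat k * esym k * A (n - k))"
    by (subst sum.atLeast_Suc_atMost) auto
  also have "\<dots> = (\<Sum>K\<in>compositions n. of_nat (comp_weight K) * esym_comp K)"
    unfolding A_def sum_compositions_Cons [OF assms] sum_distrib_left
    by (simp add: comp_weight_Cons mult_ac)
  finally show ?thesis .
qed

text \<open>For \<open>1 \<le> c \<le> n\<close> this will be the tadpole with a cycle of
  \<open>n - c + 1\<close> vertices and \<open>c - 1\<close> further vertices on its tail, a
  one-vertex cycle counting as 0 (see \<open>tadpole_expansion\<close>). In particular
  \<open>theta_sum n 1\<close> is the cycle on \<open>n\<close> vertices.\<close>

definition theta_sum :: "nat \<Rightarrow> nat \<Rightarrow> 'a" where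
  "theta_sum n c = (\<Sum>K\<in>compositions n. of_nat (Theta_up K c * comp_weight K) * esym_comp K)"

text \<open>The counterpart of \<open>ip_closed_walk_Suc\<close>. From \<open>c\<close> to
  \<open>Suc c\<close> the gap drops by one, unless \<open>c\<close> is a partial sum; in that case
  \<open>K = I @ J\<close>, and the correction factors into a path term in \<open>I\<close> and a
  cycle term in \<open>J\<close>.\<close>

lemma theta_sum_step:
  assumes "1 \<le> c" "c < n"
  shows "theta_sum n c = theta_sum n (Suc c) + path_sum n - path_sum c * theta_sum (n - c) 1"
proof -
  \<comment> \<open>The value of \<open>Theta_up K c\<close> when \<open>c\<close> is not a partial
    sum. At a partial sum the true value is 0, and \<open>?s K\<close> is too large by
    \<open>hd J\<close>.\<close>
  let ?s = "\<lambda>K. Theta_up K (Suc c) + 1"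
  let ?t = "\<lambda>K. of_nat (?s K * comp_weight K) * esym_comp K"
  have split: "Theta_up (I @ J) c = 0 \<and> ?s (I @ J) = hd J \<and> Theta_up J 1 = hd J - 1 \<and> J \<noteq> [] \<and> I \<noteq> []"
    if IJ: "I \<in> compositions c" "J \<in> compositions (n - c)" for I J
  proof -
    have I: "sum_list I = c" "I \<noteq> []" using IJ assms by (auto simp: compositions_def)
    obtain j J' where J: "J = j # J'" "j \<ge> 1" "sum_list J' + j + c = n"
      using IJ(2) assms by (cases J) (auto simp: compositions_def)
    then have "Theta_up J 1 = hd J - 1"
      by (simp add: Theta_up_first)
    moreover have "Theta_up (I @ J) c = 0"
      using I J by (simp add: Theta_up_append Theta_up_0)
    moreover have "Theta_up (I @ J) (Suc c) = Theta_up J 1"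
      using I J by (subst Theta_up_append) auto
    ultimately show ?thesis using I J by auto
  qed
  have in_ps: "\<exists>I J. K = I @ J \<and> I \<in> compositions c \<and> J \<in> compositions (n - c)"
    if "K \<in> compositions n" "c \<in> partial_sums K" for K
    using that by (fastforce simp: partial_sums_iff compositions_def)
  have "theta_sum n c = (\<Sum>K\<in>compositions n. ?t K - (if c \<in> partial_sums K then ?t K else 0))"
    unfolding theta_sum_def
  proof (rule sum.cong)
    fix K assume K: "K \<in> compositions n"
    show "of_nat (Theta_up K c * comp_weight K) * esym_comp K =
        ?t K - (if c \<in> partial_sums K then ?t K else 0)"
    proof (cases "c \<in> partial_sums K")
      case True
      then obtain I J where "K = I @ J" "I \<in> compositions c" "J \<in> compositions (n - c)"
        using in_ps [OF K] by blast
      then have "Theta_up K c = 0" using split by simp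
      then show ?thesis using True by simp
    next
      case False
      then have "Theta_up K c = ?s K"
        using K assms Theta_up_step [of c K] by (simp add: compositions_def)
      then show ?thesis using False by simp
    qed
  qed simp
  also have "\<dots> = theta_sum n (Suc c) + path_sum n - (\<Sum>K | K \<in> compositions n \<and> c \<in> partial_sums K. ?t K)"
  proof -
    have "(\<Sum>K\<in>compositions n. ?t K) = theta_sum n (Suc c) + path_sum n"
      using assms by (simp add: theta_sum_def path_sum_expansion sum.distrib [symmetric] ring_distribs add.commute)
    then show ?thesis
      unfolding sum_subtractf by (simp only: sum.inter_filter [OF finite_compositions])
  qed
  also have "(\<Sum>K | K \<in> compositions n \<and> c \<in> partial_sums K. ?t K) = path_sum c * theta_sum (n - c) 1"
  proof -
    have "?t (I @ J) = of_nat (comp_weight I) * esym_comp I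
        * (of_nat (Theta_up J 1 * comp_weight J) * esym_comp J)"
      if "I \<in> compositions c" "J \<in> compositions (n - c)" for I J
    proof -
      have "?s (I @ J) * comp_weight (I @ J) = comp_weight I * (Theta_up J 1 * comp_weight J)"
        using comp_weight_append [of I J] split [OF that] by (simp add: mult_ac)
      then show ?thesis by (simp only: of_nat_mult esym_comp_simps mult_ac)
    qed
    then have "(\<Sum>I\<in>compositions c. \<Sum>J\<in>compositions (n - c). ?t (I @ J)) =
        (\<Sum>I\<in>compositions c. \<Sum>J\<in>compositions (n - c). of_nat (comp_weight I) * esym_comp I
          * (of_nat (Theta_up J 1 * comp_weight J) * esym_comp J))"
      by (intro sum.cong refl)
    then show ?thesis
      unfolding theta_sum_def path_sum_expansion [OF assms(1)] sum_product
        sum_compositions_split [OF less_imp_le [OF assms(2)]] .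
  qed
  finally show ?thesis .
qed

lemma theta_sum_self: "theta_sum n n = 0"
proof -
  have "Theta_up K n = 0" if "K \<in> compositions n" for K
    using that Theta_up_append [of K n "[]"] by (simp add: Theta_up_0 compositions_def)
  then show ?thesis by (simp add: theta_sum_def)
qed

lemma ip_walk_walk: "ip (walk k) (walk m) = path_sum (Suc (k + m))"
proof -
  have "ip (walk k) (walk m) = ip (\<lambda>_. 1) ((step ^^ k) (walk m))"
    unfolding walk_def [of k] by (rule ip_step_pow)
  then show ?thesis by (simp add: path_sum_def step_pow_walk)
qed

text \<open>Both sides obey the same recursion, which turns a cycle vertex into a tail vertex, and
  both vanish for a one-vertex cycle.\<close>

lemma tadpole_expansion: "ip (walk k) (closed_walk m) = theta_sum (Suc (k + m)) (Suc k)"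
proof (induction m arbitrary: k)
  case 0
  then show ?case by (simp add: theta_sum_self closed_walk_0 ip_def)
next
  case (Suc m)
  have "ip (walk k) (closed_walk (Suc m)) = theta_sum (Suc (k + Suc m)) (Suc (Suc k))
      + path_sum (Suc (k + Suc m)) - path_sum (Suc k) * theta_sum (Suc m) 1"
    using Suc [of "Suc k"] Suc [of 0] ip_walk_walk [of k "Suc m"] ip_walk_walk [of k 0]
    by (simp add: ip_closed_walk_Suc walk_Suc walk_0)
  then show ?case
    by (subst theta_sum_step) simp_all
qed

text \<open>Opening the first cycle by \<open>ip_closed_walk\<close> leaves tadpoles whose cycle is
  the second one, multiplied by smaller cycles.\<close>

lemma kayak_expansion:
  "ip (closed_walk p) ((step ^^ l) (closed_walk q)) =
    of_nat p * theta_sum (p + q + l + 1) (p + l + 1)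
    - (\<Sum>i=1..p. theta_sum i 1 * theta_sum (p + q + l + 1 - i) (p + l + 1 - i))"
proof -
  have *: "ip ((step ^^ l) (closed_walk q)) (walk k) = theta_sum (Suc (l + k + q)) (Suc (l + k))" for k
    using tadpole_expansion [of "l + k" q]
    by (simp add: ip_step_pow step_pow_walk ip_commute [of "closed_walk q"])
  \<comment> \<open>The new index counts the vertices of the smaller cycle instead of its steps,
    hence the shift by one.\<close>
  have "(\<Sum>i<p. theta_sum (Suc (l + (p - Suc i) + q)) (Suc (l + (p - Suc i))) * theta_sum (Suc i) 1) =
      (\<Sum>i=1..p. theta_sum i 1 * theta_sum (p + q + l + 1 - i) (p + l + 1 - i))"
    by (rule sum.reindex_bij_witness [where i = "\<lambda>i. i - 1" and j = Suc])
       (auto simp: add_ac Suc_diff_Suc mult.commute)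
  moreover have "ip (\<lambda>_. 1) (closed_walk i) = theta_sum (Suc i) 1" for i
    using tadpole_expansion [of 0 i] by (simp add: walk_0)
  moreover have "theta_sum (Suc (l + p + q)) (Suc (l + p)) = theta_sum (p + q + l + 1) (p + l + 1)"
    by (simp add: add_ac)
  ultimately show ?thesis
    unfolding ip_commute [of "closed_walk p"] ip_closed_walk [of "(step ^^ l) (closed_walk q)"] *
    by simp
qed

lemma theta_sum_mult:
  assumes "1 \<le> i" "i \<le> c" "c \<le> n"
  shows "theta_sum i 1 * theta_sum (n - i) (c - i) =
    (\<Sum>I\<in>compositions i. \<Sum>J\<in>compositions (n - i).
      of_nat ((hd I - 1) * comp_weight I * comp_weight J * Theta_up (I @ J) c) * esym_comp (I @ J))"
  unfolding theta_sum_def sum_product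
proof (intro sum.cong refl)
  fix I J assume IJ: "I \<in> compositions i" "J \<in> compositions (n - i)"
  then have I: "sum_list I = i" "sum_list J = n - i" by (auto simp: compositions_def)
  obtain k I' where "I = k # I'" "k \<ge> 1" using IJ(1) assms by (cases I) (auto simp: compositions_def)
  then have "Theta_up I 1 = hd I - 1" by (simp add: Theta_up_first)
  moreover have "Theta_up J (c - i) = Theta_up (I @ J) c"
    using I assms by (subst Theta_up_append) auto
  ultimately show "of_nat (Theta_up I 1 * comp_weight I) * esym_comp I
      * (of_nat (Theta_up J (c - i) * comp_weight J) * esym_comp J) =
    of_nat ((hd I - 1) * comp_weight I * comp_weight J * Theta_up (I @ J) c) * esym_comp (I @ J)"
    by (simp add: mult_ac)
qed

end

section \<open>The identity between coefficients\<close>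

text \<open>\<open>\<epsilon> K\<close> stands for the coefficient of \<open>e\<^sub>K\<close> at a fixed monomial.\<close>

locale kayak_coefficients =
  fixes a l n :: nat and \<epsilon> :: "nat list \<Rightarrow> rat"
  assumes a_ge: "2 \<le> a" and al_le: "a + l \<le> n"
    and \<epsilon>_cong: "\<And>K L. mset K = mset L \<Longrightarrow> \<epsilon> K = \<epsilon> L"
begin

definition coeff_g :: "nat list \<Rightarrow> rat" where
  "coeff_g K = of_nat (Theta_up K (a + l)) * of_nat (comp_weight K) * \<epsilon> K"

definition splits :: "(nat list \<times> nat list) set" where
  "splits = {(I, J). I \<noteq> [] \<and> J \<noteq> [] \<and> I @ J \<in> compositions n \<and> sum_list I < a}"

definition split_term :: "nat list \<times> nat list \<Rightarrow> rat" where
  "split_term = (\<lambda>(I, J). of_nat ((hd I - 1) * comp_weight I * comp_weight J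
      * Theta_up (I @ J) (a + l)) * \<epsilon> (I @ J))"

text \<open>In \<open>near\<close> the first part of \<open>J\<close> ends by \<open>a + l\<close>,
  so \<open>Theta_up\<close> depends only on what follows it; in \<open>far\<close> that part
  reaches beyond \<open>a + l\<close>.\<close>

abbreviation near :: "(nat list \<times> nat list) set" where
  "near \<equiv> {(I, J) \<in> splits. sum_list I + hd J \<le> a + l}"

abbreviation far :: "(nat list \<times> nat list) set" where
  "far \<equiv> {(I, J) \<in> splits. \<not> sum_list I + hd J \<le> a + l}"

lemma finite_splits: "finite splits"
proof (rule finite_subset)
  show "splits \<subseteq> (\<lambda>(K, i). (take i K, drop i K)) ` (SIGMA K:compositions n. {..length K})"
  proof
    fix p assume "p \<in> splits"
    then obtain I J where "p = (I, J)" "I @ J \<in> compositions n" by (auto simp: splits_def)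
    then show "p \<in> (\<lambda>(K, i). (take i K, drop i K)) ` (SIGMA K:compositions n. {..length K})"
      by (intro image_eqI [of _ _ "(I @ J, length I)"]) auto
  qed
qed (simp add: finite_compositions)

text \<open>The factor \<open>hd I - 1\<close> completes the symmetric product
  \<open>part_prod I\<close>, so only \<open>hd I\<close> still singles out a part of
  \<open>I\<close>. The factors \<open>hd J * part_prod I * part_prod (tl J)\<close> are the weight
  of a composition starting with \<open>hd J\<close>.\<close>

lemma split_term_eq:
  assumes "I \<noteq> []" "J \<noteq> []"
  shows "split_term (I, J) = of_nat (hd I * hd J * part_prod I * part_prod (tl J)
      * Theta_up (I @ J) (a + l)) * \<epsilon> (I @ J)"
  using assms by (cases I; cases J) (simp_all add: split_term_def comp_weight_Cons)

text \<open>The total of \<open>hd I\<close> over the \<open>near\<close> pairs rearranging to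
  \<open>K\<close>. The two bounds in \<open>min\<close> come from \<open>sum_list I < a\<close> and
  from \<open>sum_list I + hd J \<le> a + l\<close>.\<close>

definition inner_sum :: "nat list \<Rightarrow> nat" where
  "inner_sum K = (if hd K \<le> a + l then sigma_down (tl K) (min (a - 1) (a + l - hd K)) else 0)"

text \<open>Moving \<open>j\<^sub>1\<close> to the front and reversing \<open>I\<close> turns \<open>i\<^sub>1\<close> into the last part of a prefix, and
  the last parts of all prefixes below a bound add up to the largest such partial sum.\<close>

lemma sum_near: "(\<Sum>p\<in>near. split_term p) = (\<Sum>K\<in>compositions n. of_nat (inner_sum K) * coeff_g K)"
proof -
  \<comment> \<open>The lengths of \<open>I\<close> for which cutting \<open>K\<close> gives back a
    \<open>near\<close> pair.\<close>
  define idx where "idx = (\<lambda>K. {i. 1 \<le> i \<and> i \<le> length (tl K) \<and> sum_list (take i (tl K)) < a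
      \<and> hd K + sum_list (take i (tl K)) \<le> a + l})"
  have fin: "finite (idx K)" for K
    by (rule finite_subset [of _ "{..length (tl K)}"]) (auto simp: idx_def)
  have inner: "inner_sum K = (\<Sum>i\<in>idx K. tl K ! (i - 1))" for K
  proof (cases "hd K \<le> a + l")
    case True
    then have "idx K = {i. 1 \<le> i \<and> i \<le> length (tl K)
        \<and> sum_list (take i (tl K)) \<le> min (a - 1) (a + l - hd K)}"
      using a_ge by (auto simp: idx_def)
    then show ?thesis using True by (simp only: inner_sum_def sum_last_parts if_True)
  next
    case False
    then have "idx K = {}" by (auto simp: idx_def)
    with False show ?thesis by (simp add: inner_sum_def)
  qed
  have "(\<Sum>K\<in>compositions n. of_nat (inner_sum K) * coeff_g K) =
      (\<Sum>(K, i)\<in>(SIGMA K:compositions n. idx K). of_nat (tl K ! (i - 1)) * coeff_g K)"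
    by (subst sum.Sigma [symmetric])
       (simp_all add: finite_compositions fin inner sum_distrib_right)
  also have "\<dots> = (\<Sum>p\<in>near. split_term p)"
  proof (rule sum.reindex_bij_witness [where
        i = "\<lambda>(I, J). (hd J # rev I @ tl J, length I)" and
        j = "\<lambda>(K, i). (rev (take i (tl K)), hd K # drop i (tl K))"])
    fix p assume "p \<in> (SIGMA K:compositions n. idx K)"
    then obtain K i where p: "p = (K, i)" "K \<in> compositions n" "i \<in> idx K" by auto
    define k where "k = hd K"
    define P where "P = take i (tl K)"
    define Q where "Q = drop i (tl K)"
    have i: "1 \<le> i" "i \<le> length (tl K)" using p by (auto simp: idx_def)
    then have K: "K = k # P @ Q" "length P = i" "P \<noteq> []" by (cases K; auto simp: P_def Q_def k_def)+
    have n: "k + sum_list P + sum_list Q = n"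
      and pos: "1 \<le> k" "\<forall>k\<in>set P. k \<ge> 1" "\<forall>k\<in>set Q. k \<ge> 1"
      using p(2) K by (auto simp: compositions_def)
    have le: "sum_list P < a" "k + sum_list P \<le> a + l"
      using p(3) K by (auto simp: idx_def)
    let ?c = "\<lambda>(K, i). (rev (take i (tl K)), hd K # drop i (tl K))"
    have cp: "?c p = (rev P, k # Q)" using p(1) K by simp
    show "(case ?c p of (I, J) \<Rightarrow> (hd J # rev I @ tl J, length I)) = p"
      using K p(1) by (simp add: cp)
    show "?c p \<in> near"
      using K n pos le by (auto simp: cp splits_def compositions_def)
    \<comment> \<open>Both orders have a prefix of sum \<open>k + sum_list P\<close>, at most
      \<open>a + l\<close>, followed by the same \<open>Q\<close>.\<close>
    have "Theta_up ((rev P @ [k]) @ Q) (a + l) = Theta_up Q (a + l - (k + sum_list P))"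
      by (subst Theta_up_append) (use le n al_le in \<open>auto simp: add.commute\<close>)
    moreover have "Theta_up ((k # P) @ Q) (a + l) = Theta_up Q (a + l - (k + sum_list P))"
      by (subst Theta_up_append) (use le n al_le in auto)
    moreover have "\<epsilon> (rev P @ k # Q) = \<epsilon> (k # P @ Q)"
      by (rule \<epsilon>_cong) simp
    moreover have "hd (rev P) = (P @ Q) ! (i - 1)"
      using K i by (simp add: hd_rev last_conv_nth nth_append)
    ultimately show "split_term (?c p) = (case p of (K, i) \<Rightarrow> of_nat (tl K ! (i - 1)) * coeff_g K)"
      using K p(1) by (simp add: cp split_term_eq coeff_g_def comp_weight_Cons)
  next
    fix p assume "p \<in> near"
    then obtain I j J where p: "p = (I, j # J)" "I \<noteq> []" "I @ j # J \<in> compositions n"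
      "sum_list I < a" "sum_list I + j \<le> a + l"
      by (auto simp: splits_def neq_Nil_conv)
    then show "(case (case p of (I, J) \<Rightarrow> (hd J # rev I @ tl J, length I)) of
        (K, i) \<Rightarrow> (rev (take i (tl K)), hd K # drop i (tl K))) = p"
      by simp
    show "(case p of (I, J) \<Rightarrow> (hd J # rev I @ tl J, length I)) \<in> (SIGMA K:compositions n. idx K)"
      using p by (auto simp: idx_def compositions_def Suc_le_eq)
  qed
  finally show ?thesis ..
qed

section \<open>The pairs in \<open>kayak_H\<close> and the values of
  \<open>inner_sum\<close>\<close>

lemma kayak_H_iff:
  "(I, J) \<in> kayak_H n a l \<longleftrightarrow> I \<noteq> [] \<and> J \<noteq> [] \<and> I @ J \<in> compositions_ge2 n
    \<and> a + l < sum_list I + hd J \<and> sum_list I < a"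
  unfolding kayak_H_def by auto

lemma kayak_H_E:
  assumes "p \<in> kayak_H n a l"
  obtains i I j J where "p = (i # I, j # J)" "2 \<le> i" "2 \<le> j" "\<forall>k\<in>set I. k \<ge> 2" "\<forall>k\<in>set J. k \<ge> 2"
    "i + sum_list I + j + sum_list J = n" "a + l < i + sum_list I + j" "i + sum_list I < a"
proof -
  obtain I J where "p = (I, J)" by (cases p)
  with assms that show ?thesis
    by (cases I; cases J) (auto simp: kayak_H_iff compositions_ge2_def compositions_def)
qed

text \<open>Pairs of \<open>far\<close> outside \<open>kayak_H\<close> have a part 1, which cannot
  be \<open>hd J\<close> and so makes the weight vanish. The quotient converts the two separate
  weights into that of \<open>I @ J\<close>.\<close>

lemma sum_far:
  "(\<Sum>p\<in>far. split_term p) = (\<Sum>(I, J)\<in>kayak_H n a l.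
    (of_nat (hd I) - 1) * of_nat (hd J) / (of_nat (hd J) - 1) * coeff_g (I @ J))"
proof -
  have "(\<Sum>p\<in>far. split_term p) = (\<Sum>p\<in>kayak_H n a l. split_term p)"
  proof (rule sum.mono_neutral_right)
    show "finite far" by (rule finite_subset [OF _ finite_splits]) auto
    show "kayak_H n a l \<subseteq> far"
      by (auto simp: kayak_H_iff splits_def compositions_ge2_def)
    show "\<forall>p\<in>far - kayak_H n a l. split_term p = 0"
    proof
      fix p assume "p \<in> far - kayak_H n a l"
      then obtain I j J where p: "p = (I, j # J)" "I \<noteq> []" "I @ j # J \<in> compositions n"
        "sum_list I < a" "a + l < sum_list I + j" "(I, j # J) \<notin> kayak_H n a l"
        by (auto simp: splits_def neq_Nil_conv)
      then have "I @ j # J \<notin> compositions_ge2 n" by (auto simp: kayak_H_iff)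
      then obtain k where k: "k \<in> set (I @ j # J)" "k < 2" "k \<ge> 1"
        using p(3) by (force simp: compositions_ge2_def compositions_def)
      moreover have "j \<ge> 2" using p by simp
      ultimately have "1 \<in> set I \<union> set J" by (auto simp: le_antisym numeral_2_eq_2 less_Suc_eq_le)
      then have "part_prod I = 0 \<or> part_prod J = 0"
        using part_prod_eq_0 [of I] part_prod_eq_0 [of J] by auto
      then show "split_term p = 0" using p by (auto simp: split_term_eq)
    qed
  qed
  also have "\<dots> = (\<Sum>(I, J)\<in>kayak_H n a l.
    (of_nat (hd I) - 1) * of_nat (hd J) / (of_nat (hd J) - 1) * coeff_g (I @ J))"
  proof (rule sum.cong)
    fix p assume "p \<in> kayak_H n a l"
    then show "split_term p = (case p of (I, J) \<Rightarrow>
        (of_nat (hd I) - 1) * of_nat (hd J) / (of_nat (hd J) - 1) * coeff_g (I @ J))"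
    proof (cases rule: kayak_H_E)
      case (1 i I j J)
      then have "of_nat j - 1 \<noteq> (0 :: rat)" by simp
      with 1 show ?thesis
        by (simp add: split_term_eq coeff_g_def comp_weight_Cons of_nat_diff field_simps)
    qed
  qed simp
  finally show ?thesis .
qed

text \<open>Here \<open>a - 1\<close> is the smaller bound in \<open>inner_sum\<close>. For
  \<open>hd K = 1\<close> the right side is \<open>Theta_down K a\<close>.\<close>

lemma inner_sum_small:
  assumes "hd K \<le> l + 1" "K \<noteq> []"
  shows "rat_of_nat a - 1 - of_nat (inner_sum K) = of_nat (Theta_down K (hd K + a - 1))"
proof -
  obtain k L where K: "K = k # L" using assms(2) by (cases K) auto
  have "Theta_down K (hd K + a - 1) = a - 1 - sigma_down L (a - 1)"
    using a_ge by (simp add: K Theta_down_def sigma_down_Cons)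
  moreover have "inner_sum K = sigma_down L (a - 1)"
    using assms a_ge by (simp add: K inner_sum_def min_def)
  moreover have "sigma_down L (a - 1) \<le> a - 1" by (rule sigma_down_props)
  ultimately show ?thesis using a_ge by (simp add: of_nat_diff)
qed

text \<open>Here \<open>a + l - hd K\<close> is the smaller bound in
  \<open>inner_sum\<close>.\<close>

lemma inner_sum_mid:
  assumes "l + 1 \<le> hd K" "hd K \<le> a + l" "K \<noteq> []"
  shows "rat_of_nat a - 1 - of_nat (inner_sum K) =
    of_nat (Theta_down K (a + l)) + of_nat (hd K) - of_nat l - 1"
proof -
  obtain k L where K: "K = k # L" using assms(3) by (cases K) auto
  have "Theta_down K (a + l) = a + l - k - sigma_down L (a + l - k)"
    using assms by (simp add: K Theta_down_def sigma_down_Cons)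
  moreover have "inner_sum K = sigma_down L (a + l - k)"
  proof -
    have "min (a - 1) (a + l - k) = a + l - k" using assms K by simp
    then show ?thesis using assms by (simp add: K inner_sum_def)
  qed
  moreover have "sigma_down L (a + l - k) \<le> a + l - k" by (rule sigma_down_props)
  ultimately show ?thesis using assms K by (simp add: of_nat_diff)
qed

lemma inner_sum_large:
  assumes "a + l \<le> hd K"
  shows "inner_sum K = 0"
  using assms sigma_down_props(2) [of "tl K" 0] by (simp add: inner_sum_def)

text \<open>The parts of \<open>I\<close> fit below the bound, while \<open>hd J\<close> overshoots
  it.\<close>

lemma inner_sum_H:
  assumes "(I, J) \<in> kayak_H n a l"
  shows "rat_of_nat (inner_sum (I @ J)) = of_nat (sum_list I) - of_nat (hd I)"
  using assms
proof (cases rule: kayak_H_E)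
  case (1 i I' j J')
  then have "inner_sum (I @ J) = sigma_down (I' @ j # J') (min (a - 1) (a + l - i))"
    by (simp add: inner_sum_def)
  also have "\<dots> = sum_list I'"
    by (rule sigma_down_append) (use 1 in auto)
  finally show ?thesis using 1 by simp
qed

text \<open>\<open>Theta_up K a > l\<close> means that a single part of \<open>K\<close> crosses
  both \<open>a\<close> and \<open>a + l\<close>. Cutting before it gives a pair of
  \<open>kayak_H\<close>, unless a part 1 makes the term zero.\<close>

lemma sum_H_append:
  "(\<Sum>K | K \<in> compositions n \<and> \<not> Theta_up K a \<le> l \<and> 2 \<le> hd K \<and> hd K \<le> l + a - 1. f K * coeff_g K) =
    (\<Sum>(I, J)\<in>kayak_H n a l. f (I @ J) * coeff_g (I @ J))"
proof -
  let ?M = "{K. K \<in> compositions n \<and> \<not> Theta_up K a \<le> l \<and> 2 \<le> hd K \<and> hd K \<le> l + a - 1}"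
  have "(\<Sum>K\<in>?M. f K * coeff_g K) = (\<Sum>K\<in>(\<lambda>(I, J). I @ J) ` kayak_H n a l. f K * coeff_g K)"
  proof (rule sum.mono_neutral_right)
    show "finite ?M" by (rule finite_subset [OF _ finite_compositions [of n]]) auto
    show "(\<lambda>(I, J). I @ J) ` kayak_H n a l \<subseteq> ?M"
    proof (rule image_subsetI)
      fix p assume "p \<in> kayak_H n a l"
      then show "(case p of (I, J) \<Rightarrow> I @ J) \<in> ?M"
      proof (cases rule: kayak_H_E)
        case (1 i I j J)
        then have "Theta_up ((i # I) @ j # J) a = Theta_up (j # J) (a - (i + sum_list I))"
          by (subst Theta_up_append) auto
        also have "\<dots> = j - (a - (i + sum_list I))"
          by (rule Theta_up_first) (use 1 in auto)
        finally show ?thesis using 1 by (auto simp: compositions_def)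
      qed
    qed
    show "\<forall>K\<in>?M - (\<lambda>(I, J). I @ J) ` kayak_H n a l. f K * coeff_g K = 0"
    proof
      fix K assume K: "K \<in> ?M - (\<lambda>(I, J). I @ J) ` kayak_H n a l"
      then have "a \<le> sum_list K" using al_le by (auto simp: compositions_def)
      note up = sigma_up_props [OF this]
      \<comment> \<open>Cut \<open>K\<close> before the part that reaches \<open>a\<close>.\<close>
      obtain I J where IJ: "K = I @ J" "sigma_down K (a - 1) = sum_list I"
        using sigma_down_props(1) [of K "a - 1"] by (auto simp: partial_sums_iff)
      have I: "sum_list I < a"
        using sigma_down_props(2) [of K "a - 1"] IJ a_ge by simp
      with \<open>a \<le> sum_list K\<close> obtain j J' where J: "J = j # J'"
        using IJ by (cases J) auto
      have ps: "sum_list I + j \<in> partial_sums K"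
        using IJ J by (auto simp: partial_sums_iff intro: exI [of _ "I @ [j]"])
      have "j \<ge> 1" using K IJ J by (auto simp: compositions_def)
      then have "a \<le> sum_list I + j"
        using sigma_down_props(3) [OF ps, of "a - 1"] IJ by linarith
      then have "a + l < sum_list I + j"
        using up(3) [OF ps] up(2) K by (auto simp: Theta_up_def)
      moreover from this have "I \<noteq> []" using K IJ J a_ge by auto
      ultimately have "K \<notin> compositions_ge2 n"
        using K IJ J I by (force simp: kayak_H_iff)
      then obtain k where "k \<in> set K" "k < 2" "k \<ge> 1" "2 \<le> hd K"
        using K by (force simp: compositions_ge2_def compositions_def)
      then have "1 \<in> set (tl K)" by (cases K) (auto simp: numeral_2_eq_2 less_Suc_eq_le le_antisym)
      then have "comp_weight K = 0" using \<open>2 \<le> hd K\<close> part_prod_eq_0 [of "tl K"]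
        by (simp add: comp_weight_def part_prod_def)
      then show "f K * coeff_g K = 0" by (simp add: coeff_g_def)
    qed
  qed
  also have "\<dots> = (\<Sum>(I, J)\<in>kayak_H n a l. f (I @ J) * coeff_g (I @ J))"
  proof (subst sum.reindex)
    show "inj_on (\<lambda>(I, J). I @ J) (kayak_H n a l)"
    proof (rule inj_onI, clarify)
      fix I J I' J' assume H: "(I, J) \<in> kayak_H n a l" "(I', J') \<in> kayak_H n a l" "I @ J = I' @ J'"
      then obtain L where L: "I = I' @ L \<and> L @ J = J' \<or> I @ L = I' \<and> J = L @ J'"
        unfolding append_eq_append_conv2 by blast
      \<comment> \<open>Otherwise the crossing part of one pair would lie inside the first component
        of the other, whose sum stays below \<open>a\<close>.\<close>
      have "L = []"
      proof (rule ccontr)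
        assume "L \<noteq> []"
        then obtain k M where k: "L = k # M" by (cases L) auto
        from L show False
        proof
          assume "I = I' @ L \<and> L @ J = J'"
          with H(1,2) k show False by (auto simp: kayak_H_iff)
        next
          assume "I @ L = I' \<and> J = L @ J'"
          with H(1,2) k show False by (auto simp: kayak_H_iff)
        qed
      qed
      with L show "I = I' \<and> J = J'" by simp
    qed
  qed (simp add: case_prod_unfold)
  finally show ?thesis .
qed


text \<open>The coefficient left after subtracting the \<open>far\<close> term, by
  \<open>i - (i - 1) * j / (j - 1) = (j - i) / (j - 1)\<close>.\<close>

abbreviation excess :: "nat list \<times> nat list \<Rightarrow> rat" where
  "excess \<equiv> \<lambda>(I, J). of_nat a - 1 - of_nat (sum_list I)
    + (of_nat (hd J) - of_nat (hd I)) / (of_nat (hd J) - 1)"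

text \<open>Exchanging the first parts of \<open>I\<close> and \<open>J\<close> keeps the sum up to
  the end of the crossing part, hence \<open>Theta_up\<close>, and also \<open>\<epsilon>\<close>.
  Only the weight changes, from \<open>i * (j - 1)\<close> to \<open>j * (i - 1)\<close>.\<close>

lemma swap_term:
  assumes "(I, J) \<in> kayak_H n a l" "hd I > hd J"
  shows "excess (I, J) * coeff_g (I @ J)
      + excess (hd J # tl I, hd I # tl J) * coeff_g ((hd J # tl I) @ hd I # tl J) =
    ((of_nat (hd I) - of_nat (hd J)) + (of_nat a - 1 - of_nat (sum_list I))
      * (1 + of_nat (hd J) / of_nat (hd I) * ((of_nat (hd I) - 1) / (of_nat (hd J) - 1))))
    * coeff_g (I @ J)"
  using assms(1)
proof (cases rule: kayak_H_E)
  case (1 i I' j J')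
  have up: "Theta_up (I @ J) (a + l) = Theta_up ((j # I') @ i # J') (a + l)"
  proof -
    have "Theta_up ((i # I') @ j # J') (a + l) = Theta_up (j # J') (a + l - (i + sum_list I'))"
      by (subst Theta_up_append) (use 1 in auto)
    also have "\<dots> = j - (a + l - (i + sum_list I'))"
      by (rule Theta_up_first) (use 1 in auto)
    also have "\<dots> = i - (a + l - (j + sum_list I'))"
      using 1 assms(2) by simp
    also have "\<dots> = Theta_up (i # J') (a + l - (j + sum_list I'))"
      by (rule Theta_up_first [symmetric]) (use 1 assms(2) in auto)
    also have "\<dots> = Theta_up ((j # I') @ i # J') (a + l)"
      by (subst Theta_up_append) (use 1 assms(2) in auto)
    finally show ?thesis using 1 by simp
  qed
  have eps: "\<epsilon> (I @ J) = \<epsilon> ((j # I') @ i # J')"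
    by (rule \<epsilon>_cong) (use 1 in auto)
  \<comment> \<open>The factor unaffected by the exchange.\<close>
  define g where "g = rat_of_nat (Theta_up (I @ J) (a + l) * part_prod I' * part_prod J') * \<epsilon> (I @ J)"
  have "coeff_g (I @ J) = of_nat i * (of_nat j - 1) * g"
    using 1 by (simp add: coeff_g_def g_def comp_weight_Cons of_nat_diff mult_ac)
  moreover have "coeff_g ((j # I') @ i # J') = of_nat j * (of_nat i - 1) * g"
    using 1 unfolding coeff_g_def g_def up eps
    by (simp add: comp_weight_Cons of_nat_diff mult_ac)
  moreover have "rat_of_nat i \<noteq> 0" "rat_of_nat i - 1 \<noteq> 0" "rat_of_nat j - 1 \<noteq> 0"
    using 1 by simp_all
  moreover have alg: "(A - i' + (j' - i') / (j' - 1)) * (i' * (j' - 1) * g)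
      + (A - j' + (i' - j') / (i' - 1)) * (j' * (i' - 1) * g) =
      (i' - j' + (A - i') * (1 + j' / i' * ((i' - 1) / (j' - 1)))) * (i' * (j' - 1) * g)"
    if "i' \<noteq> 0" "i' - 1 \<noteq> 0" "j' - 1 \<noteq> 0" for A i' j' :: rat
  proof -
    have "(A - i' + (j' - i') / (j' - 1)) * (i' * (j' - 1) * g) =
        ((A - i') * (j' - 1) + (j' - i')) * i' * g"
      using that by (simp add: field_simps)
    moreover have "(A - j' + (i' - j') / (i' - 1)) * (j' * (i' - 1) * g) =
        ((A - j') * (i' - 1) + (i' - j')) * j' * g"
      using that by (simp add: field_simps)
    moreover have "(i' - j' + (A - i') * (1 + j' / i' * ((i' - 1) / (j' - 1)))) * (i' * (j' - 1) * g) =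
        ((i' - j') * i' * (j' - 1) + (A - i') * (i' * (j' - 1) + j' * (i' - 1))) * g"
      using that by (simp add: divide_simps)
    ultimately show ?thesis by (simp add: algebra_simps)
  qed
  moreover define A where "A = rat_of_nat a - 1 - of_nat (sum_list I')"
  moreover have "rat_of_nat a - 1 - of_nat (sum_list I) = A - of_nat i"
    "rat_of_nat a - 1 - of_nat (sum_list (j # I')) = A - of_nat j"
    using 1 by (simp_all add: A_def)
  moreover have "hd I = i" "hd J = j" "tl I = I'" "tl J = J'" using 1 by simp_all
  ultimately show ?thesis
    by (simp only: prod.case list.sel alg)
qed

text \<open>The exchange is a bijection between \<open>?U\<close>, where the fraction in
  \<open>excess\<close> is negative, and \<open>?R\<close>, the pairs in neither \<open>?C\<close>
  nor \<open>?U\<close>. The condition \<open>sum_list I + hd J < a + hd I\<close> in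
  \<open>?R\<close> keeps the exchanged prefix below \<open>a\<close>.\<close>

lemma sum_excess:
  "(\<Sum>(I, J)\<in>kayak_H n a l. excess (I, J) * coeff_g (I @ J)) =
    (\<Sum>(I, J) | (I, J) \<in> kayak_H n a l \<and> (hd I \<ge> l + 2 \<longrightarrow>
        hd I = hd J \<or> int (sum_list I) \<ge> int a + int (hd I) - int (hd J)).
      excess (I, J) * coeff_g (I @ J))
    + (\<Sum>(I, J) | (I, J) \<in> kayak_H n a l \<and> hd I > hd J.
      ((of_nat (hd I) - of_nat (hd J)) + (of_nat a - 1 - of_nat (sum_list I))
        * (1 + of_nat (hd J) / of_nat (hd I) * ((of_nat (hd I) - 1) / (of_nat (hd J) - 1))))
      * coeff_g (I @ J))"
proof -
  let ?H = "kayak_H n a l"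
  let ?C = "{(I, J). (I, J) \<in> ?H \<and> (hd I \<ge> l + 2 \<longrightarrow>
        hd I = hd J \<or> int (sum_list I) \<ge> int a + int (hd I) - int (hd J))}"
  let ?U = "{(I, J). (I, J) \<in> ?H \<and> hd I > hd J}"
  let ?R = "{(I, J). (I, J) \<in> ?H \<and> hd I \<ge> l + 2 \<and> hd I < hd J \<and> sum_list I + hd J < a + hd I}"
  let ?e = "\<lambda>(I, J). excess (I, J) * coeff_g (I @ J)"
  let ?s = "\<lambda>(I, J). (hd J # tl I, hd I # tl J)"
  have "?H = ?C \<union> (?U \<union> ?R)"
  proof (intro equalityI subsetI)
    fix p assume "p \<in> ?H"
    then show "p \<in> ?C \<union> (?U \<union> ?R)" by (cases p) auto
  qed auto
  \<comment> \<open>In \<open>kayak_H\<close> always \<open>hd J \<ge> l + 2\<close>, so in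
    \<open>?U\<close> also \<open>hd I \<ge> l + 2\<close>; the alternative for
    \<open>sum_list I\<close> in \<open>?C\<close> would then force it above
    \<open>a\<close>.\<close>
  moreover have "?C \<inter> (?U \<union> ?R) = {}"
    by (auto simp: kayak_H_iff)
  moreover have fin: "finite ?C" "finite ?U" "finite ?R"
    by (auto intro: finite_subset [OF _ finite_kayak_H [of n a l]])
  ultimately have "sum ?e ?H = sum ?e ?C + sum ?e (?U \<union> ?R)"
    by (metis (no_types, lifting) finite_Un sum.union_disjoint)
  also have "sum ?e (?U \<union> ?R) = sum ?e ?U + sum ?e ?R"
    by (rule sum.union_disjoint [OF fin(2,3)]) auto
  also have "sum ?e ?R = (\<Sum>p\<in>?U. ?e (?s p))"
  proof (rule sum.reindex_bij_witness [where i = ?s and j = ?s])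
    fix p assume "p \<in> ?R"
    then have p: "p \<in> ?H" "p \<in> ?R" by auto
    from this(1) show "?s p \<in> ?U"
    proof (cases rule: kayak_H_E)
      case (1 i I j J)
      then show ?thesis using p(2)
        by (auto simp: kayak_H_iff compositions_ge2_def compositions_def)
    qed
    from p(1) show "?s (?s p) = p" by (cases rule: kayak_H_E) auto
    then show "?e (?s (?s p)) = ?e p" by simp
  next
    fix p assume "p \<in> ?U"
    then have p: "p \<in> ?H" "p \<in> ?U" by auto
    from this(1) show "?s p \<in> ?R"
    proof (cases rule: kayak_H_E)
      case (1 i I j J)
      then show ?thesis using p(2)
        by (auto simp: kayak_H_iff compositions_ge2_def compositions_def)
    qed
    from p(1) show "?s (?s p) = p" by (cases rule: kayak_H_E) auto
  qed
  also have "sum ?e ?U + (\<Sum>p\<in>?U. ?e (?s p)) = (\<Sum>p\<in>?U. ?e p + ?e (?s p))"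
    by (simp add: sum.distrib)
  also have "\<dots> = (\<Sum>(I, J)\<in>?U.
      ((of_nat (hd I) - of_nat (hd J)) + (of_nat a - 1 - of_nat (sum_list I))
        * (1 + of_nat (hd J) / of_nat (hd I) * ((of_nat (hd I) - 1) / (of_nat (hd J) - 1))))
      * coeff_g (I @ J))"
  proof (rule sum.cong)
    fix p assume "p \<in> ?U"
    then obtain I J where "p = (I, J)" "(I, J) \<in> ?H" "hd I > hd J" by auto
    then show "?e p + ?e (?s p) = (case p of (I, J) \<Rightarrow>
        ((of_nat (hd I) - of_nat (hd J)) + (of_nat a - 1 - of_nat (sum_list I))
        * (1 + of_nat (hd J) / of_nat (hd I) * ((of_nat (hd I) - 1) / (of_nat (hd J) - 1))))
      * coeff_g (I @ J))"
      using swap_term [of I J] by (simp only: prod.case)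
  qed simp
  finally show ?thesis .
qed

text \<open>The \<open>near\<close> pairs give every \<open>K\<close> the coefficient
  \<open>a - 1 - inner_sum K\<close>. This is evaluated by the size of \<open>hd K\<close>, except
  where \<open>Theta_up K a > l\<close>; those compositions are matched with \<open>kayak_H\<close>
  and combined with the \<open>far\<close> pairs.\<close>

lemma kayak_coefficient_identity:
  "(of_nat a - 1) * (\<Sum>K\<in>compositions n. coeff_g K) - (\<Sum>p\<in>splits. split_term p) =
      (\<Sum>K | K \<in> compositions n \<and> hd K = 1. of_nat (Theta_down K a) * coeff_g K)
    + (\<Sum>K | K \<in> compositions n \<and> Theta_up K a \<le> l \<and> 2 \<le> hd K \<and> hd K \<le> l + 1.
         of_nat (Theta_down K (hd K + a - 1)) * coeff_g K)
    + (\<Sum>K | K \<in> compositions n \<and> Theta_up K a \<le> l \<and> l + 2 \<le> hd K \<and> hd K \<le> l + a - 1.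
         (of_nat (Theta_down K (a + l)) + of_nat (hd K) - of_nat l - 1) * coeff_g K)
    + (\<Sum>K | K \<in> compositions n \<and> hd K \<ge> a + l. (of_nat a - 1) * coeff_g K)
    + (\<Sum>(I, J) | (I, J) \<in> kayak_H n a l \<and> (hd I \<ge> l + 2 \<longrightarrow>
        hd I = hd J \<or> int (sum_list I) \<ge> int a + int (hd I) - int (hd J)).
      excess (I, J) * coeff_g (I @ J))
    + (\<Sum>(I, J) | (I, J) \<in> kayak_H n a l \<and> hd I > hd J.
      ((of_nat (hd I) - of_nat (hd J)) + (of_nat a - 1 - of_nat (sum_list I))
        * (1 + of_nat (hd J) / of_nat (hd I) * ((of_nat (hd I) - 1) / (of_nat (hd J) - 1))))
      * coeff_g (I @ J))"
proof -
  let ?H = "kayak_H n a l" and ?C = "compositions n"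
  let ?c = "\<lambda>K. rat_of_nat a - 1 - of_nat (inner_sum K)"
  let ?S1 = "{K. K \<in> ?C \<and> hd K = 1}"
  let ?S2 = "{K. K \<in> ?C \<and> Theta_up K a \<le> l \<and> 2 \<le> hd K \<and> hd K \<le> l + 1}"
  let ?S3 = "{K. K \<in> ?C \<and> Theta_up K a \<le> l \<and> l + 2 \<le> hd K \<and> hd K \<le> l + a - 1}"
  let ?S4 = "{K. K \<in> ?C \<and> hd K \<ge> a + l}"
  let ?M = "{K. K \<in> ?C \<and> \<not> Theta_up K a \<le> l \<and> 2 \<le> hd K \<and> hd K \<le> l + a - 1}"
  let ?r = "\<lambda>(I, J). (of_nat (hd I) - 1) * of_nat (hd J) / (of_nat (hd J) - 1) * coeff_g (I @ J)"
  have K_ne: "K \<noteq> [] \<and> 1 \<le> hd K" if "K \<in> ?C" for K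
    using that a_ge al_le by (cases K) (auto simp: compositions_def)
  have "splits = near \<union> far" "near \<inter> far = {}" by auto
  moreover have "finite near" "finite far" by (auto intro: finite_subset [OF _ finite_splits])
  ultimately have "sum split_term splits = sum split_term near + sum split_term far"
    by (metis (no_types, lifting) sum.union_disjoint)
  then have "(of_nat a - 1) * (\<Sum>K\<in>?C. coeff_g K) - sum split_term splits =
      (\<Sum>K\<in>?C. ?c K * coeff_g K) - (\<Sum>p\<in>?H. ?r p)"
    by (simp add: sum_near sum_far sum_distrib_left sum_subtractf [symmetric] left_diff_distrib)
  also have "(\<Sum>K\<in>?C. ?c K * coeff_g K) = (\<Sum>K\<in>?S1. ?c K * coeff_g K) + (\<Sum>K\<in>?S2. ?c K * coeff_g K)
      + (\<Sum>K\<in>?S3. ?c K * coeff_g K) + (\<Sum>K\<in>?S4. ?c K * coeff_g K) + (\<Sum>K\<in>?M. ?c K * coeff_g K)"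
  proof -
    \<comment> \<open>Exactly one of the five conditions holds, the first part being
      positive.\<close>
    have "?c K * coeff_g K = (if hd K = 1 then ?c K * coeff_g K else 0)
        + (if Theta_up K a \<le> l \<and> 2 \<le> hd K \<and> hd K \<le> l + 1 then ?c K * coeff_g K else 0)
        + (if Theta_up K a \<le> l \<and> l + 2 \<le> hd K \<and> hd K \<le> l + a - 1 then ?c K * coeff_g K else 0)
        + (if a + l \<le> hd K then ?c K * coeff_g K else 0)
        + (if \<not> Theta_up K a \<le> l \<and> 2 \<le> hd K \<and> hd K \<le> l + a - 1 then ?c K * coeff_g K else 0)"
      if "K \<in> ?C" for K
    proof -
      have "hd K = 1 \<or> 2 \<le> hd K \<and> hd K \<le> l + 1 \<or> l + 2 \<le> hd K \<and> hd K \<le> l + a - 1 \<or> a + l \<le> hd K"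
        using K_ne [OF that] by linarith
      then show ?thesis using a_ge by auto
    qed
    then show ?thesis
      unfolding sum.inter_filter [OF finite_compositions] sum.distrib [symmetric]
      by (rule sum.cong [OF refl])
  qed
  also have "(\<Sum>K\<in>?M. ?c K * coeff_g K) = (\<Sum>(I, J)\<in>?H. ?c (I @ J) * coeff_g (I @ J))"
    by (rule sum_H_append [of ?c])
  also have "(\<Sum>K\<in>?S1. ?c K * coeff_g K) = (\<Sum>K\<in>?S1. of_nat (Theta_down K a) * coeff_g K)"
    using inner_sum_small K_ne by (intro sum.cong) auto
  also have "(\<Sum>K\<in>?S2. ?c K * coeff_g K) = (\<Sum>K\<in>?S2. of_nat (Theta_down K (hd K + a - 1)) * coeff_g K)"
    using inner_sum_small K_ne by (intro sum.cong) auto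
  also have "(\<Sum>K\<in>?S3. ?c K * coeff_g K) =
      (\<Sum>K\<in>?S3. (of_nat (Theta_down K (a + l)) + of_nat (hd K) - of_nat l - 1) * coeff_g K)"
    using inner_sum_mid K_ne by (intro sum.cong) auto
  also have "(\<Sum>K\<in>?S4. ?c K * coeff_g K) = (\<Sum>K\<in>?S4. (of_nat a - 1) * coeff_g K)"
    using inner_sum_large by (intro sum.cong) auto
  also have "x1 + x2 + x3 + x4 + (\<Sum>(I, J)\<in>?H. ?c (I @ J) * coeff_g (I @ J)) - (\<Sum>p\<in>?H. ?r p) =
      x1 + x2 + x3 + x4 + (\<Sum>(I, J)\<in>?H. excess (I, J) * coeff_g (I @ J))" for x1 x2 x3 x4
  proof -
    have "(\<Sum>p\<in>?H. (case p of (I, J) \<Rightarrow> ?c (I @ J) * coeff_g (I @ J)) - ?r p) =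
        (\<Sum>(I, J)\<in>?H. excess (I, J) * coeff_g (I @ J))"
    proof (rule sum.cong)
      fix p assume p: "p \<in> ?H"
      then show "(case p of (I, J) \<Rightarrow> ?c (I @ J) * coeff_g (I @ J)) - ?r p =
          (case p of (I, J) \<Rightarrow> excess (I, J) * coeff_g (I @ J))"
      proof (cases rule: kayak_H_E)
        case (1 i I j J)
        then have "rat_of_nat j - 1 \<noteq> 0" by simp
        then have *: "(rat_of_nat i - 1) * of_nat j / (of_nat j - 1) =
            of_nat i - (of_nat j - of_nat i) / (of_nat j - 1)"
          by (simp add: field_simps)
        have "rat_of_nat (inner_sum ((i # I) @ j # J)) = of_nat (sum_list (i # I)) - of_nat i"
          using inner_sum_H [of "i # I" "j # J"] p 1(1) by simp
        then have "?c ((i # I) @ j # J) - (of_nat i - 1) * of_nat j / (of_nat j - 1) =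
            excess (i # I, j # J)"
          unfolding * by simp
        then show ?thesis
          unfolding 1(1) prod.case list.sel left_diff_distrib [symmetric] by simp
      qed
    qed simp
    then show ?thesis by (simp add: sum_subtractf)
  qed
  finally show ?thesis by (simp only: sum_excess add.assoc)
qed

end

section \<open>Restriction to finitely many variables\<close>

text \<open>Sets all variables with index outside \<open>S\<close> to zero. The coefficient at a
  monomial with support in \<open>S\<close> survives, which reduces the claim to finitely many
  colours.\<close>

definition mfps_restrict :: "nat set \<Rightarrow> 'a::comm_ring_1 mfps \<Rightarrow> 'a mfps" where
  "mfps_restrict S f = Abs_mfps (\<lambda>M. if set_mset M \<subseteq> S then mfps_coeff f M else 0)"

lemma mfps_coeff_restrict:
  "mfps_coeff (mfps_restrict S f) M = (if set_mset M \<subseteq> S then mfps_coeff f M else 0)"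
  by (simp add: mfps_restrict_def)

lemma mfps_restrict_1: "mfps_restrict S 1 = 1"
  by (rule mfps_ext) (simp add: mfps_coeff_restrict mfps_coeff_1)

text \<open>Both factors of a monomial have support in \<open>S\<close> exactly when their product
  has.\<close>

lemma mfps_restrict_mult: "mfps_restrict S (f * g) = mfps_restrict S f * mfps_restrict S g"
proof (rule mfps_ext)
  fix M
  have "(\<Sum>(A, B) | A + B = M. mfps_coeff (mfps_restrict S f) A * mfps_coeff (mfps_restrict S g) B) =
      (\<Sum>(A, B) | A + B = M. if set_mset M \<subseteq> S then mfps_coeff f A * mfps_coeff g B else 0)"
    by (rule sum.cong) (auto simp: mfps_coeff_restrict)
  then show "mfps_coeff (mfps_restrict S (f * g)) M =
      mfps_coeff (mfps_restrict S f * mfps_restrict S g) M"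
    by (simp add: mfps_coeff_restrict mfps_coeff_mult)
qed

lemma mfps_restrict_prod_list:
  "mfps_restrict S (prod_list (map f K)) = prod_list (map (\<lambda>k. mfps_restrict S (f k)) K)"
  by (induction K) (simp_all add: mfps_restrict_1 mfps_restrict_mult)

text \<open>Once only finitely many members survive, the formal sum is an ordinary sum in the
  ring.\<close>

lemma mfps_restrict_formal_sum_monom:
  assumes "\<And>i. i \<in> A \<Longrightarrow> f i = mfps_monom (N i)"
    and fin: "finite {i \<in> A. set_mset (N i) \<subseteq> S}"
  shows "mfps_restrict S (mfps_formal_sum f A) = (\<Sum>i | i \<in> A \<and> set_mset (N i) \<subseteq> S. f i)"
proof (rule mfps_ext)
  fix M
  have "mfps_coeff (\<Sum>i | i \<in> A \<and> set_mset (N i) \<subseteq> S. f i) M =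
      (\<Sum>i | i \<in> A \<and> set_mset (N i) \<subseteq> S. if N i = M then 1 else 0)"
    unfolding mfps_coeff_sum by (rule sum.cong) (auto simp: assms mfps_monom_def)
  also have "\<dots> = of_nat (card ({i \<in> A. set_mset (N i) \<subseteq> S} \<inter> {i. N i = M}))"
    using fin by (simp add: sum.If_cases)
  also have "{i \<in> A. set_mset (N i) \<subseteq> S} \<inter> {i. N i = M} =
      (if set_mset M \<subseteq> S then {i \<in> A. N i = M} else {})"
    by auto
  finally show "mfps_coeff (mfps_restrict S (mfps_formal_sum f A)) M =
      mfps_coeff (\<Sum>i | i \<in> A \<and> set_mset (N i) \<subseteq> S. f i) M"
    by (simp add: mfps_coeff_restrict mfps_coeff_formal_sum_monom [of A f N] assms)
qed

lemma mfps_coeff_of_nat_mult: "mfps_coeff (of_nat k * f) M = of_nat k * mfps_coeff f M"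
  by (induction k) (simp_all add: distrib_right)

lemma mfps_restrict_elem_sym:
  assumes "finite S"
  shows "mfps_restrict S (elem_sym k) =
    (\<Sum>J | J \<subseteq> S \<inter> {1..} \<and> card J = k. \<Prod>i\<in>J. mfps_var i)"
proof -
  let ?A = "{J. J \<subseteq> {1::nat..} \<and> finite J \<and> card J = k}"
  have *: "{J \<in> ?A. set_mset (mset_set J) \<subseteq> S} = {J. J \<subseteq> S \<inter> {1..} \<and> card J = k}"
  proof -
    have "finite J" if "J \<subseteq> S" for J using assms that by (rule rev_finite_subset)
    then show ?thesis by auto
  qed
  have "finite {J. J \<subseteq> S \<inter> {1..} \<and> card J = k}"
    by (rule finite_subset [of _ "Pow S"]) (use assms in auto)
  then show ?thesis
    unfolding elem_sym_def
    by (subst mfps_restrict_formal_sum_monom [where N = mset_set])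
       (simp_all only: * , simp add: prod_mfps_var [where \<kappa> = "\<lambda>i. i", simplified])
qed

lemma mfps_restrict_chrom_sym:
  assumes "finite V" "finite S"
  shows "mfps_restrict S (chrom_sym V E) =
    (\<Sum>\<kappa>\<in>V \<rightarrow>\<^sub>E S \<inter> {1..}. of_bool (\<forall>u v. {u, v} \<in> E \<longrightarrow> \<kappa> u \<noteq> \<kappa> v) * (\<Prod>v\<in>V. mfps_var (\<kappa> v)))"
proof -
  let ?N = "\<lambda>\<kappa>. image_mset \<kappa> (mset_set V)"
  have *: "{\<kappa> \<in> proper_colorings V E. set_mset (?N \<kappa>) \<subseteq> S} =
      {\<kappa> \<in> V \<rightarrow>\<^sub>E S \<inter> {1..}. \<forall>u v. {u, v} \<in> E \<longrightarrow> \<kappa> u \<noteq> \<kappa> v}"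
    using assms by (auto simp: proper_colorings_def PiE_iff)
  have fin: "finite (V \<rightarrow>\<^sub>E S \<inter> {1..})"
    by (rule finite_PiE) (use assms in auto)
  then have "mfps_restrict S (chrom_sym V E) =
      (\<Sum>\<kappa> | \<kappa> \<in> V \<rightarrow>\<^sub>E S \<inter> {1..} \<and> (\<forall>u v. {u, v} \<in> E \<longrightarrow> \<kappa> u \<noteq> \<kappa> v). \<Prod>v\<in>V. mfps_var (\<kappa> v))"
    unfolding chrom_sym_def * [symmetric]
    by (intro mfps_restrict_formal_sum_monom) (simp add: prod_mfps_var assms, simp only: *, simp)
  then show ?thesis
    using fin by (simp add: sum.inter_filter of_bool_def if_distrib [of "\<lambda>c. c * _"] cong: if_cong)
qed

theorem theorem5p1:
  fixes V :: "'v set" and E :: "'v set set" and a b l n :: nat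
  assumes "a \<ge> 3" and "b \<ge> 3" and "n = a + b + l - 1"
    and "kayak_paddle a b l V E"
  shows "(chrom_sym V E :: rat mfps) =
      (\<Sum>K | K \<in> compositions n \<and> hd K = 1.
         mfps_const (of_nat (Theta_down K a)) * kayak_g a l K)
    + (\<Sum>K | K \<in> compositions n \<and> Theta_up K a \<le> l \<and> 2 \<le> hd K \<and> hd K \<le> l + 1.
         mfps_const (of_nat (Theta_down K (hd K + a - 1))) * kayak_g a l K)
    + (\<Sum>K | K \<in> compositions n \<and> Theta_up K a \<le> l \<and> l + 2 \<le> hd K \<and> hd K \<le> l + a - 1.
         mfps_const (of_nat (Theta_down K (a + l)) + of_nat (hd K) - of_nat l - 1) * kayak_g a l K)
    + (\<Sum>K | K \<in> compositions n \<and> hd K \<ge> a + l.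
         mfps_const (of_nat a - 1) * kayak_g a l K)
    + (\<Sum>(I, J) | (I, J) \<in> kayak_H n a l \<and>
           (hd I \<ge> l + 2 \<longrightarrow>
             hd I = hd J \<or> int (sum_list I) \<ge> int a + int (hd I) - int (hd J)).
         mfps_const (of_nat a - 1 - of_nat (sum_list I)
             + (of_nat (hd J) - of_nat (hd I)) / (of_nat (hd J) - 1)) * kayak_g a l (I @ J))
    + (\<Sum>(I, J) | (I, J) \<in> kayak_H n a l \<and> hd I > hd J.
         mfps_const ((of_nat (hd I) - of_nat (hd J))
             + (of_nat a - 1 - of_nat (sum_list I))
               * (1 + of_nat (hd J) / of_nat (hd I)
                    * ((of_nat (hd I) - 1) / (of_nat (hd J) - 1)))) * kayak_g a l (I @ J))"
    (is "_ = ?rhs")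
proof (rule mfps_ext)
  fix M :: "nat multiset"
  \<comment> \<open>The colours are the variables of the monomial whose coefficient is
    compared.\<close>
  define S where "S = set_mset M"
  define \<epsilon> where "\<epsilon> = (\<lambda>K. mfps_coeff (elem_sym_comp K :: rat mfps) M)"
  have "finite S" by (simp add: S_def)
  \<comment> \<open>The weights are the variables themselves, as elements of the power series ring;
    index 0 is not a colour.\<close>
  interpret weighted_colours "S \<inter> {1..}" "mfps_var :: nat \<Rightarrow> rat mfps"
    by unfold_locales (simp add: S_def)
  interpret kayak_coefficients a l n \<epsilon>
  proof
    fix K L :: "nat list" assume "mset K = mset L"
    then have "mset (map elem_sym K) = (mset (map elem_sym L) :: rat mfps multiset)" by simp
    then show "\<epsilon> K = \<epsilon> L"
      unfolding \<epsilon>_def elem_sym_comp_def by (metis prod_mset_prod_list)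
  qed (use assms in auto)
  have coeff_S: "mfps_coeff (mfps_restrict S f) M = mfps_coeff f M" for f :: "rat mfps"
    by (simp add: mfps_coeff_restrict S_def)
  have esym: "esym = (\<lambda>k. mfps_restrict S (elem_sym k))"
    by (rule ext) (simp only: esym_eq mfps_restrict_elem_sym [OF \<open>finite S\<close>])
  have "esym_comp K = mfps_restrict S (elem_sym_comp K)" for K
    unfolding esym_comp_def elem_sym_comp_def mfps_restrict_prod_list esym ..
  then have coeff: "mfps_coeff (of_nat k * esym_comp K) M = of_nat k * \<epsilon> K" for k K
    by (simp add: mfps_coeff_of_nat_mult coeff_S \<epsilon>_def)
  have coeff_g: "mfps_coeff (kayak_g a l K) M = coeff_g K" for K
    unfolding coeff_g_def by (simp add: kayak_g_def \<epsilon>_def)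
  have V: "finite V"
    using assms(4) by (auto simp: kayak_paddle_def)
  have "mfps_coeff (chrom_sym V E :: rat mfps) M = mfps_coeff (mfps_restrict S (chrom_sym V E)) M"
    by (simp only: coeff_S)
  also have "mfps_restrict S (chrom_sym V E) =
      ip (closed_walk (a - 1)) ((step ^^ l) (closed_walk (b - 1)))"
    unfolding mfps_restrict_chrom_sym [OF V \<open>finite S\<close>] kayak_colourings [OF assms(4)] ..
  also have "\<dots> = of_nat (a - 1) * theta_sum n (a + l)
      - (\<Sum>i=1..a - 1. theta_sum i 1 * theta_sum (n - i) (a + l - i))"
  proof -
    have "n = a - 1 + (b - 1) + l + 1" "a + l = a - 1 + l + 1" using assms by auto
    then show ?thesis by (simp only: kayak_expansion)
  qed
  also have "mfps_coeff \<dots> M = (of_nat a - 1) * (\<Sum>K\<in>compositions n. coeff_g K)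
      - (\<Sum>i=1..a - 1. \<Sum>I\<in>compositions i. \<Sum>J\<in>compositions (n - i). split_term (I, J))"
  proof -
    have "(\<Sum>i=1..a - 1. mfps_coeff (theta_sum i 1 * theta_sum (n - i) (a + l - i)) M) =
        (\<Sum>i=1..a - 1. \<Sum>I\<in>compositions i. \<Sum>J\<in>compositions (n - i). split_term (I, J))"
    proof (rule sum.cong)
      fix i assume i: "i \<in> {1..a - 1}"
      have "theta_sum i 1 * theta_sum (n - i) (a + l - i) =
          (\<Sum>I\<in>compositions i. \<Sum>J\<in>compositions (n - i). of_nat ((hd I - 1) * comp_weight I
            * comp_weight J * Theta_up (I @ J) (a + l)) * esym_comp (I @ J))"
        by (rule theta_sum_mult) (use i assms in auto)
      then show "mfps_coeff (theta_sum i 1 * theta_sum (n - i) (a + l - i)) M =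
          (\<Sum>I\<in>compositions i. \<Sum>J\<in>compositions (n - i). split_term (I, J))"
        by (simp only: mfps_coeff_sum coeff split_term_def prod.case)
    qed simp
    moreover have "mfps_coeff (theta_sum n (a + l)) M = (\<Sum>K\<in>compositions n. coeff_g K)"
      unfolding theta_sum_def mfps_coeff_sum coeff coeff_g_def by simp
    moreover have "rat_of_nat (a - 1) = of_nat a - 1"
      using assms(1) by (simp add: of_nat_diff)
    ultimately show ?thesis
      by (simp only: mfps_coeff_diff mfps_coeff_of_nat_mult mfps_coeff_sum)
  qed
  also have "(\<Sum>i=1..a - 1. \<Sum>I\<in>compositions i. \<Sum>J\<in>compositions (n - i). split_term (I, J)) =
      (\<Sum>p\<in>splits. split_term p)"
  proof -
    \<comment> \<open>A pair is indexed by the sum of its first component, which lies between 1 and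
      \<open>a - 1\<close>.\<close>
    have "(\<Sum>p\<in>splits. split_term p) =
        (\<Sum>(i, p)\<in>(SIGMA i:{1..a - 1}. compositions i \<times> compositions (n - i)). split_term p)"
    proof (rule sum.reindex_bij_witness [where i = snd and j = "\<lambda>p. (sum_list (fst p), p)"])
      fix p assume "p \<in> splits"
      then obtain I J where p: "p = (I, J)" "I \<noteq> []" "I @ J \<in> compositions n" "sum_list I < a"
        by (auto simp: splits_def)
      then have "1 \<le> sum_list I" by (cases I) (auto simp: compositions_def)
      with p show "(sum_list (fst p), p) \<in> (SIGMA i:{1..a - 1}. compositions i \<times> compositions (n - i))"
        by (auto simp: compositions_append_iff)
    next
      fix q assume "q \<in> (SIGMA i:{1..a - 1}. compositions i \<times> compositions (n - i))"
      then obtain i I J where q: "q = (i, I, J)" "1 \<le> i" "i < a" "I \<in> compositions i"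
        "J \<in> compositions (n - i)" by auto
      then show "snd q \<in> splits"
        using al_le by (auto simp: splits_def compositions_def)
      show "(sum_list (fst (snd q)), snd q) = q"
        using q by (simp add: compositions_def)
    qed auto
    then show ?thesis
      by (simp add: sum.Sigma sum.cartesian_product finite_compositions case_prod_unfold)
  qed
  also note kayak_coefficient_identity
  finally show "mfps_coeff (chrom_sym V E :: rat mfps) M = mfps_coeff ?rhs M"
    by (simp only: mfps_coeff_add mfps_coeff_sum mfps_coeff_const_mult coeff_g
        case_prod_unfold fst_conv snd_conv)
qed

end
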